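(* The problem of deciding, given a sequent $\Gamma$ and a TBox $\mathcal{T}$ of non-expansive fuzzy $\mathcal{ALC}$, whether $\Gamma$ is $\mathcal{T}$-satisfiable is EXPTIME-hard.
   Context: Non-expansive fuzzy $\mathcal{ALC}$: given sets $\mathsf{N_C}$ of atomic concepts and $\mathsf{N_R}$ of role names, concepts are generated by $C,D::= p\mid c\mid \neg C\mid C\ominus c\mid C\sqcap D\mid \exists R.C$ with $p\in\mathsf{N_C}$, $R\in\mathsf{N_R}$, $c\in[0,1]$ a rational constant. An interpretation $\mathcal{I}$ consists of a nonempty set $\Delta^{\mathcal{I}}$, maps $p^{\mathcal{I}}:\Delta^{\mathcal{I}}\to[0,1]$ and $R^{\mathcal{I}}:\Delta^{\mathcal{I}}\times\Delta^{\mathcal{I}}\to[0,1]$; concepts are evaluated by $c^{\mathcal{I}}(x)=c$, $(\neg C)^{\mathcal{I}}(x)=1-C^{\mathcal{I}}(x)$, $(C\ominus c)^{\mathcal{I}}(x)=\max(C^{\mathcal{I}}(x)-c,0)$, $(C\sqcap D)^{\mathcal{I}}(x)=\min(C^{\mathcal{I}}(x),D^{\mathcal{I}}(x))$, $(\exists R.C)^{\mathcal{I}}(x)=\sup_{y}\min(R^{\mathcal{I}}(x,y),C^{\mathcal{I}}(y))$. A concept assertion is $C\bowtie c$ with ${\bowtie}\in\{<,\leq,>,\geq\}$ and $c$ rational; a sequent is a finite set of concept assertions. A TBox is a finite set of GCIs $C\sqsubseteq D$, satisfied by $\mathcal{I}$ if $C^{\mathcal{I}}(x)\le D^{\mathcal{I}}(x)$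 for all GCIs and all $x\in\Delta^{\mathcal{I}}$. A sequent $\Gamma$ is $\mathcal{T}$-satisfiable if some interpretation satisfying $\mathcal{T}$ has an individual $x$ with $C^{\mathcal{I}}(x)\bowtie c$ for every $C\bowtie c\in\Gamma$. Input size is the syntactic size of $\Gamma$ and $\mathcal{T}$, with constants encoded in binary. *)

theory Defs
  imports Complex_Main "HOL-Library.Countable_Set" "HOL-Computational_Algebra.Polynomial"
begin

section \<open>Syntax and semantics of non-expansive fuzzy ALC\<close>

text \<open>Concept names and role names are both taken to be the natural numbers.\<close>

datatype concept =
    Atom nat
  | Const rat
  | Neg concept
  | Minus concept rat
  | And concept concept
  | Exists nat concept

instance concept :: countable
  by countable_datatype

primrec wf_concept :: "concept \<Rightarrow> bool" where
  "wf_concept (Atom p) \<longleftrightarrow> True"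
| "wf_concept (Const c) \<longleftrightarrow> 0 \<le> c \<and> c \<le> 1"
| "wf_concept (Neg C) \<longleftrightarrow> wf_concept C"
| "wf_concept (Minus C c) \<longleftrightarrow> wf_concept C \<and> 0 \<le> c \<and> c \<le> 1"
| "wf_concept (And C D) \<longleftrightarrow> wf_concept C \<and> wf_concept D"
| "wf_concept (Exists R C) \<longleftrightarrow> wf_concept C"

datatype comparison = Lt | Le | Gt | Ge

type_synonym assertion = "concept \<times> comparison \<times> rat"
type_synonym sequent = "assertion set"
type_synonym gci = "concept \<times> concept"
type_synonym tbox = "gci set"

definition wf_sequent :: "sequent \<Rightarrow> bool" where
  "wf_sequent \<Gamma> \<longleftrightarrow> finite \<Gamma> \<and> (\<forall>(C, r, c) \<in> \<Gamma>. wf_concept C)"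

definition wf_tbox :: "tbox \<Rightarrow> bool" where
  "wf_tbox \<T> \<longleftrightarrow> finite \<T> \<and> (\<forall>(C, D) \<in> \<T>. wf_concept C \<and> wf_concept D)"

record 'd interp =
  indiv :: "'d set"
  atom_int :: "nat \<Rightarrow> 'd \<Rightarrow> real"
  role_int :: "nat \<Rightarrow> 'd \<Rightarrow> 'd \<Rightarrow> real"

definition is_interp :: "'d interp \<Rightarrow> bool" where
  "is_interp I \<longleftrightarrow>
     indiv I \<noteq> {} \<and>
     (\<forall>p. \<forall>x\<in>indiv I. atom_int I p x \<in> {0..1}) \<and>
     (\<forall>R. \<forall>x\<in>indiv I. \<forall>y\<in>indiv I. role_int I R x y \<in> {0..1})"

primrec eval :: "'d interp \<Rightarrow> concept \<Rightarrow> 'd \<Rightarrow> real" where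
  "eval I (Atom p) x = atom_int I p x"
| "eval I (Const c) x = of_rat c"
| "eval I (Neg C) x = 1 - eval I C x"
| "eval I (Minus C c) x = max (eval I C x - of_rat c) 0"
| "eval I (And C D) x = min (eval I C x) (eval I D x)"
| "eval I (Exists R C) x = (SUP y\<in>indiv I. min (role_int I R x y) (eval I C y))"

primrec compare :: "comparison \<Rightarrow> real \<Rightarrow> real \<Rightarrow> bool" where
  "compare Lt a b \<longleftrightarrow> a < b"
| "compare Le a b \<longleftrightarrow> a \<le> b"
| "compare Gt a b \<longleftrightarrow> a > b"
| "compare Ge a b \<longleftrightarrow> a \<ge> b"

definition satisfies_tbox :: "'d interp \<Rightarrow> tbox \<Rightarrow> bool" where
  "satisfies_tbox I \<T> \<longleftrightarrow> (\<forall>(C, D) \<in> \<T>. \<forall>x\<in>indiv I. eval I C x \<le> eval I D x)"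

definition satisfies_sequent :: "'d interp \<Rightarrow> 'd \<Rightarrow> sequent \<Rightarrow> bool" where
  "satisfies_sequent I x \<Gamma> \<longleftrightarrow> (\<forall>(C, r, c) \<in> \<Gamma>. compare r (eval I C x) (of_rat c))"

text \<open>
  The existential quantifier over interpretations has to range over a fixed type of individuals.
  The lemma \<open>satisfiableI\<close> below (a downward Loewenheim-Skolem argument) shows that the choice of
  the natural numbers loses nothing: satisfaction in an interpretation over an arbitrary type
  implies satisfiability in the sense of this definition.
\<close>

definition satisfiable :: "tbox \<Rightarrow> sequent \<Rightarrow> bool" where
  "satisfiable \<T> \<Gamma> \<longleftrightarrow>
     (\<exists>I :: nat interp. is_interp I \<and> satisfies_tbox I \<T> \<and>
        (\<exists>x\<in>indiv I. satisfies_sequent I x \<Gamma>))"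

lemma Exists_bdd_above:
  assumes "is_interp I" "x \<in> indiv I" "A \<subseteq> indiv I"
  shows "bdd_above ((\<lambda>y. min (role_int I R x y) (eval I C y)) ` A)"
proof (rule bdd_aboveI2)
  fix y assume "y \<in> A"
  then have "role_int I R x y \<in> {0..1}"
    using assms unfolding is_interp_def by blast
  then show "min (role_int I R x y) (eval I C y) \<le> 1"
    by auto
qed

lemma satisfiableI:
  fixes I :: "'d interp"
  assumes I: "is_interp I" and T: "satisfies_tbox I \<T>"
    and x0: "x0 \<in> indiv I" and G: "satisfies_sequent I x0 \<Gamma>"
  shows "satisfiable \<T> \<Gamma>"
proof -
  define v where "v R C x y = min (role_int I R x y) (eval I C y)" for R C x y
  define w where "w x = (\<lambda>(R, C, n :: nat).
      SOME y. y \<in> indiv I \<and> (SUP z\<in>indiv I. v R C x z) - inverse (Suc n) < v R C x y)" for x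
  have bdd: "bdd_above (v R C x ` A)" if "x \<in> indiv I" "A \<subseteq> indiv I" for R C x A
    using Exists_bdd_above[OF I that] unfolding v_def .
  have w: "w x (R, C, n) \<in> indiv I \<and>
      (SUP z\<in>indiv I. v R C x z) - inverse (Suc n) < v R C x (w x (R, C, n))"
    if x: "x \<in> indiv I" for x R C n
  proof -
    have "\<exists>y\<in>indiv I. (SUP z\<in>indiv I. v R C x z) - inverse (Suc n) < v R C x y"
      using less_cSUP_iff[of "indiv I" "v R C x" "(SUP z\<in>indiv I. v R C x z) - inverse (Suc n)"]
        bdd[OF x] x by auto
    then have "\<exists>y. y \<in> indiv I \<and> (SUP z\<in>indiv I. v R C x z) - inverse (Suc n) < v R C x y"
      by blast
    from someI_ex[OF this] show ?thesis
      unfolding w_def by simp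
  qed
  define F where "F A = A \<union> (\<Union>x\<in>A. range (w x))" for A
  define D where "D = (\<Union>k. (F ^^ k) {x0})"
  have "countable ((F ^^ k) {x0})" for k
    by (induction k) (auto simp: F_def)
  then have count: "countable D"
    by (simp add: D_def)
  have "(F ^^ k) {x0} \<subseteq> indiv I" for k
  proof (induction k)
    case 0
    show ?case using x0 by simp
  next
    case (Suc k)
    have "w x i \<in> indiv I" if "x \<in> indiv I" for x i
      using w[OF that] by (cases i) blast
    with Suc show ?case by (auto simp: F_def)
  qed
  then have sub: "D \<subseteq> indiv I"
    by (auto simp: D_def)
  have x0D: "x0 \<in> D"
    unfolding D_def by (rule UN_I[of 0]) simp_all
  have closed: "w x i \<in> D" if "x \<in> D" for x i
  proof -
    from that obtain k where "x \<in> (F ^^ k) {x0}" by (auto simp: D_def)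
    then have "w x i \<in> (F ^^ Suc k) {x0}" by (auto simp: F_def)
    then show ?thesis unfolding D_def by blast
  qed
  define g where "g = from_nat_into D"
  have rg: "range g = D"
    unfolding g_def using count x0D by (intro range_from_nat_into) auto
  have gI: "g n \<in> indiv I" for n
    using rg sub by blast
  define J :: "nat interp" where
    "J = \<lparr>indiv = UNIV, atom_int = \<lambda>p n. atom_int I p (g n),
          role_int = \<lambda>R m n. role_int I R (g m) (g n)\<rparr>"
  have J: "is_interp J"
    using I gI unfolding is_interp_def J_def by simp
  have ev: "eval J C n = eval I C (g n)" for C n
  proof (induction C arbitrary: n)
    case (Exists R C)
    let ?x = "g n" and ?s = "SUP z\<in>indiv I. v R C (g n) z"
    have xD: "?x \<in> D" using rg by blast
    have "eval J (Exists R C) n = (SUP m. v R C ?x (g m))"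
      using Exists by (simp add: J_def v_def)
    also have "\<dots> = (SUP y\<in>D. v R C ?x y)"
      unfolding rg[symmetric] by (simp add: image_image)
    also have "\<dots> = ?s"
    proof (rule antisym)
      show "(SUP y\<in>D. v R C ?x y) \<le> ?s"
        using xD sub bdd[OF gI] by (intro cSUP_subset_mono) auto
      show "?s \<le> (SUP y\<in>D. v R C ?x y)"
      proof (rule field_le_epsilon)
        fix e :: real assume "0 < e"
        then obtain k :: nat where k: "inverse (real (Suc k)) < e"
          using reals_Archimedean by blast
        have "v R C ?x (w ?x (R, C, k)) \<le> (SUP y\<in>D. v R C ?x y)"
          using closed[OF xD] bdd[OF gI sub] by (intro cSUP_upper) auto
        with w[OF gI, of n R C k] k show "?s \<le> (SUP y\<in>D. v R C ?x y) + e"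
          by linarith
      qed
    qed
    finally show ?case by (simp add: v_def)
  qed (simp_all add: J_def)
  obtain n0 where "g n0 = x0" using x0D rg by blast
  then have "satisfies_sequent J n0 \<Gamma>"
    using G by (simp add: satisfies_sequent_def ev)
  moreover have "satisfies_tbox J \<T>"
    using T gI unfolding satisfies_tbox_def ev by blast
  ultimately show ?thesis
    using J unfolding satisfiable_def by (intro exI[of _ J]) (auto simp: J_def)
qed


section \<open>Instances as binary words\<close>

text \<open>
  All encoders below are prefix-free, so that concatenations can be decoded uniquely.
  Natural numbers are written in binary, least significant digit first, where every digit is
  announced by \<open>True\<close> and \<open>False\<close> marks the end of the number.
\<close>

fun enc_nat :: "nat \<Rightarrow> bool list" where
  "enc_nat n = (if n = 0 then [False] else True # odd n # enc_nat (n div 2))"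

declare enc_nat.simps [simp del]

definition enc_rat :: "rat \<Rightarrow> bool list" where
  "enc_rat c = (case quotient_of c of (a, b) \<Rightarrow>
     (a < 0) # enc_nat (nat \<bar>a\<bar>) @ enc_nat (nat b))"

primrec enc_concept :: "concept \<Rightarrow> bool list" where
  "enc_concept (Atom p) = [False, False, False] @ enc_nat p"
| "enc_concept (Const c) = [False, False, True] @ enc_rat c"
| "enc_concept (Neg C) = [False, True, False] @ enc_concept C"
| "enc_concept (Minus C c) = [False, True, True] @ enc_concept C @ enc_rat c"
| "enc_concept (And C D) = [True, False, False] @ enc_concept C @ enc_concept D"
| "enc_concept (Exists R C) = [True, False, True] @ enc_nat R @ enc_concept C"

primrec enc_comparison :: "comparison \<Rightarrow> bool list" where
  "enc_comparison Lt = [False, False]"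
| "enc_comparison Le = [False, True]"
| "enc_comparison Gt = [True, False]"
| "enc_comparison Ge = [True, True]"

definition enc_assertion :: "assertion \<Rightarrow> bool list" where
  "enc_assertion = (\<lambda>(C, r, c). enc_concept C @ enc_comparison r @ enc_rat c)"

definition enc_gci :: "gci \<Rightarrow> bool list" where
  "enc_gci = (\<lambda>(C, D). enc_concept C @ enc_concept D)"

primrec enc_list :: "('a \<Rightarrow> bool list) \<Rightarrow> 'a list \<Rightarrow> bool list" where
  "enc_list f [] = [False]"
| "enc_list f (x # xs) = True # f x @ enc_list f xs"

definition enc_instance :: "assertion list \<Rightarrow> gci list \<Rightarrow> bool list" where
  "enc_instance \<Gamma> \<T> = enc_list enc_assertion \<Gamma> @ enc_list enc_gci \<T>"

text \<open>
  In a word, the finite sets \<open>\<Gamma>\<close> and \<open>\<T>\<close> are given by listing their elements in an arbitrary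
  order. Words that do not encode a sequent and a TBox do not belong to the problem.
\<close>

definition fuzzy_ALC_sat :: "bool list set" where
  "fuzzy_ALC_sat =
     {enc_instance \<Gamma> \<T> | \<Gamma> \<T>.
        wf_sequent (set \<Gamma>) \<and> wf_tbox (set \<T>) \<and> satisfiable (set \<T>) (set \<Gamma>)}"

lemma enc_nat_0: "enc_nat 0 = [False]"
  by (subst enc_nat.simps) simp

lemma enc_nat_pos: "n > 0 \<Longrightarrow> enc_nat n = True # odd n # enc_nat (n div 2)"
  by (subst enc_nat.simps) simp

lemma enc_nat_prefix: "enc_nat m @ u = enc_nat n @ v \<Longrightarrow> m = n \<and> u = v"
proof (induction m arbitrary: n rule: less_induct)
  case (less m)
  consider "m = 0" "n = 0" | "m = 0" "n > 0" | "m > 0" "n = 0" | "m > 0" "n > 0"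
    by auto
  then show ?case
  proof cases
    case 4
    then have eq: "odd m = odd n" "enc_nat (m div 2) @ u = enc_nat (n div 2) @ v"
      using less.prems by (simp_all add: enc_nat_pos)
    have "m div 2 < m" using 4 by simp
    from less.IH[OF this eq(2)] have "m div 2 = n div 2" "u = v" by simp_all
    moreover from eq(1) have "m mod 2 = n mod 2" by presburger
    ultimately show ?thesis
      by (metis div_mult_mod_eq)
  qed (use less.prems in \<open>simp_all add: enc_nat_0 enc_nat_pos\<close>)
qed

lemma enc_rat_prefix:
  assumes "enc_rat c @ u = enc_rat d @ v"
  shows "c = d \<and> u = v"
proof -
  obtain a b where c: "quotient_of c = (a, b)" by fastforce
  obtain a' b' where d: "quotient_of d = (a', b')" by fastforce
  have pos: "b > 0" "b' > 0"
    using quotient_of_denom_pos[OF c] quotient_of_denom_pos[OF d] by auto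
  have sgn: "(a < 0) = (a' < 0)"
    and "enc_nat (nat \<bar>a\<bar>) @ enc_nat (nat b) @ u = enc_nat (nat \<bar>a'\<bar>) @ enc_nat (nat b') @ v"
    using assms by (simp_all add: enc_rat_def c d)
  then have "nat \<bar>a\<bar> = nat \<bar>a'\<bar>" "nat b = nat b'" "u = v"
    using enc_nat_prefix by blast+
  with sgn pos have "a = a'" "b = b'" "u = v" by linarith+
  with c d show ?thesis
    by (metis quotient_of_inject)
qed

lemma enc_nat_append_eq [simp]: "enc_nat m @ u = enc_nat n @ v \<longleftrightarrow> m = n \<and> u = v"
  using enc_nat_prefix by blast

lemma enc_rat_append_eq [simp]: "enc_rat c @ u = enc_rat d @ v \<longleftrightarrow> c = d \<and> u = v"
  using enc_rat_prefix by blast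

lemma enc_concept_append_eq [simp]:
  "enc_concept C @ u = enc_concept D @ v \<longleftrightarrow> C = D \<and> u = v"
  by (induction C arbitrary: D u v; case_tac D) simp_all

lemma enc_comparison_append_eq [simp]:
  "enc_comparison r @ u = enc_comparison s @ v \<longleftrightarrow> r = s \<and> u = v"
  by (cases r; cases s) simp_all

lemma enc_assertion_append_eq:
  "enc_assertion a @ u = enc_assertion b @ v \<longleftrightarrow> a = b \<and> u = v"
  by (cases a; cases b) (simp add: enc_assertion_def)

lemma enc_gci_append_eq: "enc_gci a @ u = enc_gci b @ v \<longleftrightarrow> a = b \<and> u = v"
  by (cases a; cases b) (simp add: enc_gci_def)

lemma enc_list_append_eq:
  assumes "\<And>a b u v. f a @ u = f b @ v \<longleftrightarrow> a = b \<and> u = v"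
  shows "enc_list f xs @ u = enc_list f ys @ v \<longleftrightarrow> xs = ys \<and> u = v"
  by (induction xs arbitrary: ys; case_tac ys) (simp_all add: assms)

lemma enc_instance_inject:
  "enc_instance \<Gamma> \<T> = enc_instance \<Gamma>' \<T>' \<longleftrightarrow> \<Gamma> = \<Gamma>' \<and> \<T> = \<T>'"
  using enc_list_append_eq[of enc_assertion \<Gamma> "enc_list enc_gci \<T>", OF enc_assertion_append_eq]
    enc_list_append_eq[of enc_gci \<T> "[]" _ "[]", OF enc_gci_append_eq]
  by (simp add: enc_instance_def)

lemma enc_instance_in_fuzzy_ALC_sat_iff:
  "enc_instance \<Gamma> \<T> \<in> fuzzy_ALC_sat \<longleftrightarrow>
     wf_sequent (set \<Gamma>) \<and> wf_tbox (set \<T>) \<and> satisfiable (set \<T>) (set \<Gamma>)"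
  by (auto simp: fuzzy_ALC_sat_def enc_instance_inject)


section \<open>Deterministic multi-tape Turing machines\<close>

text \<open>
  States and tape symbols are initial segments of the natural numbers, and tapes are infinite in
  both directions. Symbol 0 is the blank; symbols 1 and 2 are the letters of binary words.
\<close>

datatype move = MoveLeft | Stay | MoveRight

primrec offset :: "move \<Rightarrow> int" where
  "offset MoveLeft = -1"
| "offset Stay = 0"
| "offset MoveRight = 1"

record tm =
  num_tapes :: nat
  num_symbols :: nat
  num_states :: nat
  start :: nat
  accept :: nat
  reject :: nat
  delta :: "nat \<Rightarrow> nat list \<Rightarrow> nat \<times> (nat \<times> move) list"

definition halting :: "tm \<Rightarrow> nat \<Rightarrow> bool" where
  "halting M q \<longleftrightarrow> q = accept M \<or> q = reject M"

definition is_tm :: "tm \<Rightarrow> bool" where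
  "is_tm M \<longleftrightarrow>
     num_tapes M \<ge> 1 \<and> num_symbols M \<ge> 3 \<and>
     start M < num_states M \<and> accept M < num_states M \<and> reject M < num_states M \<and>
     accept M \<noteq> reject M \<and>
     (\<forall>q<num_states M. \<forall>ss. \<not> halting M q \<and> length ss = num_tapes M \<and> set ss \<subseteq> {..<num_symbols M} \<longrightarrow>
        (case delta M q ss of (q', acts) \<Rightarrow>
           q' < num_states M \<and> length acts = num_tapes M \<and> fst ` set acts \<subseteq> {..<num_symbols M}))"

type_synonym tape = "int \<Rightarrow> nat"

text \<open>A configuration consists of the state and, for each tape, its content and head position.\<close>

type_synonym config = "nat \<times> (tape \<times> int) list"

definition word_tape :: "bool list \<Rightarrow> tape" where
  "word_tape w i = (if 0 \<le> i \<and> i < int (length w) then (if w ! nat i then 2 else 1) else 0)"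

definition initial :: "tm \<Rightarrow> bool list \<Rightarrow> config" where
  "initial M w = (start M, (word_tape w, 0) # replicate (num_tapes M - 1) (\<lambda>_. 0, 0))"

definition step :: "tm \<Rightarrow> config \<Rightarrow> config" where
  "step M = (\<lambda>(q, ts).
     if halting M q then (q, ts)
     else (case delta M q (map (\<lambda>(t, h). t h) ts) of (q', acts) \<Rightarrow>
       (q', map2 (\<lambda>(t, h) (a, d). (t(h := a), h + offset d)) ts acts)))"

definition run :: "tm \<Rightarrow> bool list \<Rightarrow> nat \<Rightarrow> config" where
  "run M w t = (step M ^^ t) (initial M w)"

definition decides_in_time :: "tm \<Rightarrow> bool list set \<Rightarrow> (nat \<Rightarrow> nat) \<Rightarrow> bool" where
  "decides_in_time M L T \<longleftrightarrow>
     (\<forall>w. \<exists>t \<le> T (length w). fst (run M w t) = (if w \<in> L then accept M else reject M))"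

text \<open>The output is the content of the last tape, which must be blank outside the output word.\<close>

definition computes_in_time :: "tm \<Rightarrow> (bool list \<Rightarrow> bool list) \<Rightarrow> (nat \<Rightarrow> nat) \<Rightarrow> bool" where
  "computes_in_time M f T \<longleftrightarrow>
     (\<forall>w. \<exists>t \<le> T (length w). halting M (fst (run M w t)) \<and>
        fst (last (snd (run M w t))) = word_tape (f w))"


section \<open>EXPTIME-hardness\<close>

definition EXPTIME :: "bool list set set" where
  "EXPTIME = {L. \<exists>M (p :: nat poly). is_tm M \<and> decides_in_time M L (\<lambda>n. 2 ^ poly p n)}"

definition polytime_computable :: "(bool list \<Rightarrow> bool list) \<Rightarrow> bool" where
  "polytime_computable f \<longleftrightarrow> (\<exists>M (p :: nat poly). is_tm M \<and> computes_in_time M f (poly p))"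

definition polytime_reducible :: "bool list set \<Rightarrow> bool list set \<Rightarrow> bool" where
  "polytime_reducible L L' \<longleftrightarrow> (\<exists>f. polytime_computable f \<and> (\<forall>w. w \<in> L \<longleftrightarrow> f w \<in> L'))"

definition EXPTIME_hard :: "bool list set \<Rightarrow> bool" where
  "EXPTIME_hard L' \<longleftrightarrow> (\<forall>L \<in> EXPTIME. polytime_reducible L L')"

end

(*
  A computation of 2^e steps is described by cells: the cell at (t, i) holds the state at time t and
  the symbols at distance i from the heads at time t, so it is a function of the cells (t-1, i-1),
  (t-1, i), (t-1, i+1) and (t-1, 0). Individuals stand for such claims, and role successors for the
  claims that justify them. The binary counters that such a reduction usually needs are replaced by
  single fuzzy values: t and i are the values of two concepts, counted in units of 1/2^(e+2), and they
  are decreased by subtracting one constant whose encoding is linear in e. The input word is tested by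
  a nested concept that is followed along a role until the distance has dropped to 0. Hence the
  instance is a concatenation of fixed words, blocks repeated e times, and a homomorphic image of the
  input, and such functions are computed by simple loop programs on several tapes.
*)
theory Submission
  imports Defs
begin

section \<open>Loop programs and their Turing machines\<close>

text \<open>Many unrelated individuals may make claims about the same cell, and nothing forces them
  to coincide as in a grid. No confluence is required: the machine is deterministic, and induction
  on the remaining time shows that every claim about (t, i) is true. Suprema and inequalities shape
  the TBox. An existential of value 1 may have no successor of weight 1, only weights arbitrarily
  close to it. Hence the counters stay between 1/4 and 3/4, where edges of weight above 3/4 transmit
  them without loss, and the names that express claims are forced to be crisp, so that a value above
  3/4 is 1. Counters stay in that range because only the cells with
  \<open>\<bar>i\<bar> + int t \<le> 2 ^ e\<close> matter, the cone that can influence the cell at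
  the heads at the end. Whatever ranges over cells or windows depends on the fixed machine alone and
  has constant size in the reduction, however large it is; only the exponent \<open>e\<close> and
  the input word vary.\<close>

datatype prog = Skip | Put nat bool | Seq prog prog | Loop nat prog prog

type_synonym store = "nat \<Rightarrow> bool list"

primrec exec :: "prog \<Rightarrow> store \<Rightarrow> store" where
  "exec Skip s = s"
| "exec (Put j b) s = s(j := s j @ [b])"
| "exec (Seq P Q) s = exec Q (exec P s)"
| "exec (Loop i P Q) s = fold (\<lambda>b. if b then exec Q else exec P) (s i) s"

primrec reads :: "prog \<Rightarrow> nat set" where
  "reads Skip = {}"
| "reads (Put j b) = {}"
| "reads (Seq P Q) = reads P \<union> reads Q"
| "reads (Loop i P Q) = insert i (reads P \<union> reads Q)"

primrec writes :: "prog \<Rightarrow> nat set" where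
  "writes Skip = {}"
| "writes (Put j b) = {j}"
| "writes (Seq P Q) = writes P \<union> writes Q"
| "writes (Loop i P Q) = writes P \<union> writes Q"

text \<open>
  \<open>A\<close> is the set of tapes that enclosing loops are scanning. A loop must not write a tape that is read
  inside it: otherwise tape contents could grow exponentially.
\<close>

primrec wf_prog :: "nat \<Rightarrow> nat set \<Rightarrow> prog \<Rightarrow> bool" where
  "wf_prog K A Skip \<longleftrightarrow> True"
| "wf_prog K A (Put j b) \<longleftrightarrow> 0 < j \<and> j < K \<and> j \<notin> A"
| "wf_prog K A (Seq P Q) \<longleftrightarrow> wf_prog K A P \<and> wf_prog K A Q"
| "wf_prog K A (Loop i P Q) \<longleftrightarrow> i < K \<and> i \<notin> A \<and>
     wf_prog K (insert i A) P \<and> wf_prog K (insert i A) Q \<and>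
     insert i (reads P \<union> reads Q) \<inter> (writes P \<union> writes Q) = {}"

lemma exec_unchanged: "j \<notin> writes P \<Longrightarrow> exec P s j = s j"
proof (induction P arbitrary: s)
  case (Loop i P Q)
  have "fold (\<lambda>b. if b then exec Q else exec P) v t j = t j" for v t
    using Loop by (induction v arbitrary: t) auto
  then show ?case by simp
qed auto

section \<open>Compilation of loop programs to Turing machine instructions\<close>

primrec code_length :: "prog \<Rightarrow> nat" where
  "code_length Skip = 0"
| "code_length (Put j b) = 1"
| "code_length (Seq P Q) = code_length P + code_length Q"
| "code_length (Loop i P Q) = code_length P + code_length Q + 5"

type_synonym instr = "nat list \<Rightarrow> nat \<times> (nat \<times> move) list"

definition act_on :: "nat \<Rightarrow> nat \<Rightarrow> move \<Rightarrow> nat list \<Rightarrow> (nat \<times> move) list" where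
  "act_on j a d ss = (map (\<lambda>s. (s, Stay)) ss)[j := (a, d)]"

text \<open>A loop first steps left, because the head may rest on the blank behind the word, where
  the rewinding instruction would stop at once. State \<open>a + 1\<close> rewinds to the blank in
  front of the word, \<open>a + 2\<close> dispatches on the letter and leaves the loop at the blank
  behind it, and each body is followed by an advance to the next letter and a jump back to
  \<open>a + 2\<close>.\<close>

primrec code :: "prog \<Rightarrow> nat \<Rightarrow> instr list" where
  "code Skip a = []"
| "code (Put j b) a = [\<lambda>ss. (a + 1, act_on j (if b then 2 else 1) MoveRight ss)]"
| "code (Seq P Q) a = code P a @ code Q (a + code_length P)"
| "code (Loop i P Q) a =
    [\<lambda>ss. (a + 1, act_on i (ss ! i) MoveLeft ss),
     \<lambda>ss. if ss ! i = 0 then (a + 2, act_on i 0 MoveRight ss)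
          else (a + 1, act_on i (ss ! i) MoveLeft ss),
     \<lambda>ss. (if ss ! i = 0 then a + 5 + code_length P + code_length Q
           else if ss ! i = 1 then a + 3 else a + 4 + code_length P, act_on i (ss ! i) Stay ss)]
    @ code P (a + 3) @ [\<lambda>ss. (a + 2, act_on i (ss ! i) MoveRight ss)]
    @ code Q (a + 4 + code_length P) @ [\<lambda>ss. (a + 2, act_on i (ss ! i) MoveRight ss)]"

lemma length_code [simp]: "length (code P a) = code_length P"
  by (induction P arbitrary: a) auto

definition instr_ok :: "nat \<Rightarrow> nat \<Rightarrow> instr \<Rightarrow> bool" where
  "instr_ok K m f \<longleftrightarrow> (\<forall>ss. length ss = K \<longrightarrow> set ss \<subseteq> {..<3} \<longrightarrow>
     fst (f ss) \<le> m \<and> length (snd (f ss)) = K \<and> fst ` set (snd (f ss)) \<subseteq> {..<3})"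

lemma length_act_on [simp]: "length (act_on i a d ss) = length ss"
  by (simp add: act_on_def)

lemma set_act_on: "a < 3 \<Longrightarrow> set ss \<subseteq> {..<3} \<Longrightarrow> fst ` set (act_on i a d ss) \<subseteq> {..<3}"
  unfolding act_on_def using set_update_subset_insert[of "map (\<lambda>s. (s, Stay)) ss" i "(a, d)"]
  by fastforce

lemma nth_less_3: "i < length ss \<Longrightarrow> set ss \<subseteq> {..<3} \<Longrightarrow> ss ! i < (3::nat)"
  using nth_mem by fastforce

lemma instr_ok_code:
  "wf_prog K A P \<Longrightarrow> a + code_length P \<le> m \<Longrightarrow> f \<in> set (code P a) \<Longrightarrow> instr_ok K m f"
proof (induction P arbitrary: a A)
  case (Put j b)
  then show ?case
    using set_act_on by (auto simp: instr_ok_def)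
next
  case (Seq P Q)
  then show ?case
    using Seq.IH(1)[of A a] Seq.IH(2)[of A "a + code_length P"] by auto
next
  case (Loop i P Q)
  have i: "i < K" using Loop.prems by simp
  consider "f \<in> set (code P (a + 3))" | "f \<in> set (code Q (a + 4 + code_length P))"
    | "instr_ok K m f"
  proof -
    have ok: "instr_ok K m (\<lambda>ss. (k ss, act_on i (x ss) (d ss) ss))"
      if "\<And>ss. k ss \<le> m" "\<And>ss. x ss \<in> {0, ss ! i}" for k x d
      unfolding instr_ok_def
    proof (intro allI impI conjI)
      fix ss :: "nat list"
      assume ss: "length ss = K" "set ss \<subseteq> {..<3}"
      then have "x ss < 3"
        using nth_less_3[OF _ ss(2), of i] that(2)[of ss] i by auto
      then show "fst ` set (snd (k ss, act_on i (x ss) (d ss) ss)) \<subseteq> {..<3}"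
        using set_act_on ss(2) by simp
    qed (use that in auto)
    have 1: "instr_ok K m (\<lambda>ss. (a + 1, act_on i (ss ! i) MoveLeft ss))"
      using Loop.prems(2) by (intro ok) auto
    \<comment> \<open>The conditional is pushed into the components, which is the shape that
      \<open>ok\<close> covers.\<close>
    have "(\<lambda>ss. if ss ! i = 0 then (a + 2, act_on i 0 MoveRight ss)
          else (a + 1, act_on i (ss ! i) MoveLeft ss))
      = (\<lambda>ss. (if ss ! i = 0 then a + 2 else a + 1,
          act_on i (if ss ! i = 0 then 0 else ss ! i) (if ss ! i = 0 then MoveRight else MoveLeft) ss))"
      by auto
    moreover have "instr_ok K m \<dots>"
      using Loop.prems(2) by (intro ok) auto
    ultimately have 2: "instr_ok K m (\<lambda>ss. if ss ! i = 0 then (a + 2, act_on i 0 MoveRight ss)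
          else (a + 1, act_on i (ss ! i) MoveLeft ss))"
      by simp
    have 3: "instr_ok K m (\<lambda>ss. (if ss ! i = 0 then a + 5 + code_length P + code_length Q
        else if ss ! i = 1 then a + 3 else a + 4 + code_length P, act_on i (ss ! i) Stay ss))"
      using Loop.prems(2) by (intro ok) auto
    have 4: "instr_ok K m (\<lambda>ss. (a + 2, act_on i (ss ! i) MoveRight ss))"
      using Loop.prems(2) by (intro ok) auto
    show thesis
      using Loop.prems(3) that 1 2 3 4 by (simp only: code.simps set_append list.set Un_iff insert_iff empty_iff) blast
  qed
  then show ?case
  proof cases
    case 1
    then show ?thesis using Loop.IH(1)[of "insert i A" "a + 3"] Loop.prems by simp
  next
    case 2
    then show ?thesis using Loop.IH(2)[of "insert i A" "a + 4 + code_length P"] Loop.prems by simp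
  qed
qed auto

section \<open>Reachability and steps that touch one tape\<close>

fun code_at :: "tm \<Rightarrow> nat \<Rightarrow> instr list \<Rightarrow> bool" where
  "code_at M a [] \<longleftrightarrow> True"
| "code_at M a (f # fs) \<longleftrightarrow> \<not> halting M a \<and> delta M a = f \<and> code_at M (Suc a) fs"

lemma code_at_append [simp]:
  "code_at M a (fs @ gs) \<longleftrightarrow> code_at M a fs \<and> code_at M (a + length fs) gs"
  by (induction fs arbitrary: a) auto

definition reaches :: "tm \<Rightarrow> nat \<Rightarrow> config \<Rightarrow> config \<Rightarrow> bool" where
  "reaches M n c c' \<longleftrightarrow> (\<exists>k\<le>n. (step M ^^ k) c = c')"

lemma reaches_refl: "reaches M n c c"
  by (auto simp: reaches_def intro: exI[of _ 0])

lemma reaches_step: "step M c = c' \<Longrightarrow> reaches M 1 c c'"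
  by (auto simp: reaches_def intro: exI[of _ 1])

lemma reaches_trans:
  assumes "reaches M m c c'" "reaches M n c' c''"
  shows "reaches M (m + n) c c''"
proof -
  obtain k l where "k \<le> m" "l \<le> n" "(step M ^^ k) c = c'" "(step M ^^ l) c' = c''"
    using assms by (auto simp: reaches_def)
  then have "(step M ^^ (l + k)) c = c''" "l + k \<le> m + n"
    by (simp_all add: funpow_add)
  then show ?thesis unfolding reaches_def by blast
qed

lemma reaches_mono: "reaches M m c c' \<Longrightarrow> m \<le> n \<Longrightarrow> reaches M n c c'"
  unfolding reaches_def using order.trans by blast

definition conf :: "nat \<Rightarrow> nat \<Rightarrow> store \<Rightarrow> (nat \<Rightarrow> int) \<Rightarrow> config" where
  "conf K a s h = (a, map (\<lambda>j. (word_tape (s j), h j)) [0..<K])"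

text \<open>Covers scanning and writing at once: when \<open>s' = s\<close>, the symbol
  \<open>x\<close> is the one under the head, and a letter written at the end of a word amounts to
  appending it.\<close>

lemma step_conf:
  assumes "\<not> halting M a" "i < K"
    and "delta M a (map (\<lambda>j. word_tape (s j) (h j)) [0..<K])
         = (a', act_on i x d (map (\<lambda>j. word_tape (s j) (h j)) [0..<K]))"
    and "word_tape (s' i) = (word_tape (s i))(h i := x)" "\<And>j. j \<noteq> i \<Longrightarrow> s' j = s j"
  shows "reaches M 1 (conf K a s h) (conf K a' s' (h(i := h i + offset d)))"
proof (rule reaches_step)
  let ?ss = "map (\<lambda>j. word_tape (s j) (h j)) [0..<K]"
  have "map2 (\<lambda>(t, h) (a, d). (t(h := a), h + offset d))
        (map (\<lambda>j. (word_tape (s j), h j)) [0..<K]) (act_on i x d ?ss)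
      = map (\<lambda>j. (word_tape (s' j), (h(i := h i + offset d)) j)) [0..<K]" (is "?l = ?r")
  proof (rule nth_equalityI)
    fix j assume "j < length ?l"
    then show "?l ! j = ?r ! j"
      using assms(4,5) by (cases "j = i") (auto simp: act_on_def)
  qed (simp add: act_on_def)
  moreover have "map (\<lambda>(t, h). t h) (map (\<lambda>j. (word_tape (s j), h j)) [0..<K]) = ?ss"
    by simp
  ultimately show "step M (conf K a s h) = conf K a' s' (h(i := h i + offset d))"
    using assms(1,3) by (simp add: step_def conf_def del: map_map fun_upd_apply)
qed

text \<open>
  Outside of the loops that scan them, tapes are kept with the head at the end, ready for writing. Tape 0
  is exempt, since the head starts at the beginning of the input, and is never written.
\<close>

definition valid_heads :: "nat set \<Rightarrow> store \<Rightarrow> (nat \<Rightarrow> int) \<Rightarrow> bool" where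
  "valid_heads A s h \<longleftrightarrow> (\<forall>j. j \<notin> A \<longrightarrow>
     0 \<le> h j \<and> h j \<le> int (length (s j)) \<and> (0 < j \<longrightarrow> h j = int (length (s j))))"

lemma word_tape_snoc:
  "word_tape (u @ [b]) = (word_tape u)(int (length u) := (if b then 2 else 1))"
  by (rule ext) (auto simp: word_tape_def nth_append nat_less_iff)

lemma word_tape_Nil: "word_tape [] = (\<lambda>_. 0)"
  by (simp add: word_tape_def fun_eq_iff)

lemma word_tape_eq_0_iff: "word_tape u i = 0 \<longleftrightarrow> i < 0 \<or> int (length u) \<le> i"
  by (auto simp: word_tape_def)

text \<open>The induction counts the letters up to and including the head position, so
  \<open>p = 0\<close> is the blank at position -1, from which one step right ends the
  rewinding.\<close>

lemma reaches_rewind: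
  assumes M: "code_at M a (code (Loop i P Q) a)" and i: "i < K"
  shows "p \<le> length (s i) \<Longrightarrow>
    reaches M (p + 1) (conf K (a + 1) s (h(i := int p - 1))) (conf K (a + 2) s (h(i := 0)))"
proof (induction p)
  case 0
  have "reaches M 1 (conf K (a + 1) s (h(i := -1)))
      (conf K (a + 2) s ((h(i := -1))(i := (h(i := -1)) i + offset MoveRight)))"
    using M i by (intro step_conf[where x = 0]) (auto simp: word_tape_def)
  moreover have "(h(i := -1))(i := (h(i := -1)) i + offset MoveRight) = h(i := 0)"
    by auto
  ultimately show ?case by (simp del: fun_upd_apply)
next
  case (Suc p)
  have nb: "word_tape (s i) (int p) \<noteq> 0"
    using Suc.prems by (simp add: word_tape_eq_0_iff)
  have "reaches M 1 (conf K (a + 1) s (h(i := int p)))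
      (conf K (a + 1) s ((h(i := int p))(i := (h(i := int p)) i + offset MoveLeft)))"
    using M i nb by (intro step_conf[where x = "word_tape (s i) (int p)"]) auto
  moreover have "(h(i := int p))(i := (h(i := int p)) i + offset MoveLeft) = h(i := int p - 1)"
    by auto
  ultimately have "reaches M (1 + (p + 1)) (conf K (a + 1) s (h(i := int p))) (conf K (a + 2) s (h(i := 0)))"
    using reaches_trans Suc.IH Suc.prems by (metis Suc_leD)
  then show ?case by (simp del: fun_upd_apply)
qed

lemma fold_exec_unchanged:
  "j \<notin> writes P \<union> writes Q \<Longrightarrow> fold (\<lambda>b. if b then exec Q else exec P) v s j = s j"
  by (induction v arbitrary: s) (auto simp: exec_unchanged)

text \<open>One polynomial bounds both the time and the growth of every tape, and its argument
  bounds only the tapes that are read. So the growth is additive and independent of the length of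
  tapes that are only written; this, and the fact that the heads in \<open>A\<close> are left in
  place, is what an enclosing loop relies on.\<close>

definition simulated_within :: "nat \<Rightarrow> nat set \<Rightarrow> prog \<Rightarrow> nat poly \<Rightarrow> bool" where
  "simulated_within K A P q \<longleftrightarrow> (\<forall>M a s h N. code_at M a (code P a) \<longrightarrow> valid_heads A s h \<longrightarrow>
    (\<forall>j\<in>reads P. length (s j) \<le> N) \<longrightarrow>
    (\<exists>h'. reaches M (poly q N) (conf K a s h) (conf K (a + code_length P) (exec P s) h') \<and>
      valid_heads A (exec P s) h' \<and> (\<forall>j\<in>A. h' j = h j)) \<and>
    (\<forall>j. length (exec P s j) \<le> length (s j) + poly q N))"

lemma simulated_withinD:
  assumes "simulated_within K A P q" "code_at M a (code P a)" "valid_heads A s h"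
    "\<forall>j\<in>reads P. length (s j) \<le> N"
  obtains h' where
    "reaches M (poly q N) (conf K a s h) (conf K (a + code_length P) (exec P s) h')"
    "valid_heads A (exec P s) h'" "\<And>j. j \<in> A \<Longrightarrow> h' j = h j"
    "\<And>j. length (exec P s j) \<le> length (s j) + poly q N"
  using assms unfolding simulated_within_def by blast

lemma simulated_withinI:
  assumes "\<And>M a s h N. code_at M a (code P a) \<Longrightarrow> valid_heads A s h \<Longrightarrow>
    \<forall>j\<in>reads P. length (s j) \<le> N \<Longrightarrow>
    \<exists>h'. reaches M (poly q N) (conf K a s h) (conf K (a + code_length P) (exec P s) h') \<and>
      valid_heads A (exec P s) h' \<and> (\<forall>j\<in>A. h' j = h j) \<and>
      (\<forall>j. length (exec P s j) \<le> length (s j) + poly q N)"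
  shows "simulated_within K A P q"
  using assms unfolding simulated_within_def by blast

text \<open>The tapes read inside a loop are not written by it and keep their length, so every
  iteration obeys the bound for the same \<open>N\<close> and the total is a product of polynomials.
  Sequential composition leads to a composition of polynomials.\<close>

lemma exec_simulated:
  assumes "wf_prog K A P"
  shows "\<exists>q. simulated_within K A P q"
  using assms
proof (induction P arbitrary: A)
  case Skip
  have "simulated_within K A Skip 0"
    by (rule simulated_withinI) (auto intro: reaches_refl)
  then show ?case ..
next
  case (Put j b)
  let ?d = "if b then 2 else 1 :: nat"
  have "simulated_within K A (Put j b) 1"
  proof (rule simulated_withinI, intro exI conjI)
    fix M a s h
    assume M: "code_at M a (code (Put j b) a)" and h: "valid_heads A s h"
    have hj: "h j = int (length (s j))"
      using h Put by (auto simp: valid_heads_def)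
    have "reaches M 1 (conf K a s h) (conf K (a + code_length (Put j b)) (exec (Put j b) s)
       (h(j := h j + offset MoveRight)))"
      using M Put hj by (intro step_conf[where x = ?d]) (auto simp: word_tape_snoc)
    then show "reaches M (poly 1 N) (conf K a s h)
       (conf K (a + code_length (Put j b)) (exec (Put j b) s) (h(j := h j + offset MoveRight)))" for N
      by simp
    show "valid_heads A (exec (Put j b) s) (h(j := h j + offset MoveRight))"
      using h hj by (auto simp: valid_heads_def)
  qed (use Put in auto)
  then show ?case ..
next
  case (Seq P Q)
  then obtain p q where p: "simulated_within K A P p" and q: "simulated_within K A Q q"
    by force
  \<comment> \<open>\<open>Q\<close> may read tapes that \<open>P\<close> has lengthened to at most
    \<open>poly p N + N\<close>.\<close>
  define r where "r = p + pcompose q (p + [:0, 1:])"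
  have r: "poly r N = poly p N + poly q (poly p N + N)" for N
    by (simp add: r_def poly_pcompose)
  have "simulated_within K A (Seq P Q) r"
  proof (rule simulated_withinI)
    fix M a s h N
    assume M: "code_at M a (code (Seq P Q) a)" and h: "valid_heads A s h"
      and N: "\<forall>j\<in>reads (Seq P Q). length (s j) \<le> N"
    have MP: "code_at M a (code P a)" and MQ: "code_at M (a + code_length P) (code Q (a + code_length P))"
      using M by auto
    have NP: "\<forall>j\<in>reads P. length (s j) \<le> N"
      using N by auto
    from simulated_withinD[OF p MP h NP] obtain h1 where
      1: "reaches M (poly p N) (conf K a s h) (conf K (a + code_length P) (exec P s) h1)"
        "valid_heads A (exec P s) h1" "\<And>j. j \<in> A \<Longrightarrow> h1 j = h j"
        "\<And>j. length (exec P s j) \<le> length (s j) + poly p N"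
      by metis
    have NQ: "\<forall>j\<in>reads Q. length (exec P s j) \<le> poly p N + N"
    proof
      fix j assume "j \<in> reads Q"
      then have "length (s j) \<le> N" using N by simp
      then show "length (exec P s j) \<le> poly p N + N"
        using 1(4)[of j] by linarith
    qed
    from simulated_withinD[OF q MQ 1(2) NQ] obtain h2 where
      2: "reaches M (poly q (poly p N + N)) (conf K (a + code_length P) (exec P s) h1)
          (conf K (a + code_length P + code_length Q) (exec Q (exec P s)) h2)"
        "valid_heads A (exec Q (exec P s)) h2" "\<And>j. j \<in> A \<Longrightarrow> h2 j = h1 j"
        "\<And>j. length (exec Q (exec P s) j) \<le> length (exec P s j) + poly q (poly p N + N)"
      by metis
    show "\<exists>h'. reaches M (poly r N) (conf K a s h)
              (conf K (a + code_length (Seq P Q)) (exec (Seq P Q) s) h') \<and>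
             valid_heads A (exec (Seq P Q) s) h' \<and> (\<forall>j\<in>A. h' j = h j) \<and>
          (\<forall>j. length (exec (Seq P Q) s j) \<le> length (s j) + poly r N)"
    proof (intro conjI exI[of _ h2] allI)
      show "reaches M (poly r N) (conf K a s h)
              (conf K (a + code_length (Seq P Q)) (exec (Seq P Q) s) h2)"
        using reaches_trans[OF 1(1) 2(1)] by (simp add: r add.assoc)
      fix j
      show "length (exec (Seq P Q) s j) \<le> length (s j) + poly r N"
        using 1(4)[of j] 2(4)[of j] by (simp add: r)
    qed (use 1 2 in auto)
  qed
  then show ?case ..
next
  case (Loop i P Q)
  let ?A = "insert i A"
  from Loop obtain p q where p: "simulated_within K ?A P p" and q: "simulated_within K ?A Q q"
    by force
  have i: "i < K" "i \<notin> A" and disj: "insert i (reads P \<union> reads Q) \<inter> (writes P \<union> writes Q) = {}"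
    using Loop.prems by auto
  \<comment> \<open>An iteration costs one body, bounded by the sum of both, and two steps for
    dispatch and advance; the last summand pays for the first step left, the rewinding and the
    exit.\<close>
  define r where "r = [:0, 1:] * (p + q + [:2:]) + [:3, 1:]"
  have r: "poly r N = N * (poly p N + poly q N + 2) + N + 3" for N
    by (simp add: r_def)
  let ?body = "\<lambda>b. if b then exec Q else exec P"
  have "simulated_within K A (Loop i P Q) r"
  proof (rule simulated_withinI)
    fix M a s h N
    assume M: "code_at M a (code (Loop i P Q) a)" and h: "valid_heads A s h"
      and N: "\<forall>j\<in>reads (Loop i P Q). length (s j) \<le> N"
    let ?B = "poly p N + poly q N + 2"
    have MP: "code_at M (a + 3) (code P (a + 3))"
      and MQ: "code_at M (a + 4 + code_length P) (code Q (a + 4 + code_length P))"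
      using M by (simp_all add: eval_nat_numeral)
    \<comment> \<open>Loop invariant: \<open>u\<close> has been scanned, \<open>v\<close> is left,
      and the tapes read in the loop still have the contents they had before it.\<close>
    have iter: "(\<exists>h'. reaches M (length v * ?B + 1) (conf K (a + 2) st g)
            (conf K (a + code_length (Loop i P Q)) (fold ?body v st) h') \<and>
          valid_heads ?A (fold ?body v st) h' \<and> h' i = int (length (s i)) \<and> (\<forall>j\<in>A. h' j = g j)) \<and>
        (\<forall>j. length (fold ?body v st j) \<le> length (st j) + length v * ?B)"
      if "valid_heads ?A st g" "\<forall>j\<in>reads (Loop i P Q). st j = s j"
        "s i = u @ v" "g i = int (length u)" for u v st g
      using that
    proof (induction v arbitrary: u st g)
      case Nil
      have "reaches M 1 (conf K (a + 2) st g)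
          (conf K (a + code_length (Loop i P Q)) st (g(i := g i + offset Stay)))"
        using M i Nil by (intro step_conf[where x = 0]) (auto simp: eval_nat_numeral word_tape_def)
      moreover have "g(i := g i + offset Stay) = g" by auto
      ultimately have "reaches M (length ([] :: bool list) * ?B + 1) (conf K (a + 2) st g)
          (conf K (a + code_length (Loop i P Q)) st g)" by simp
      then show ?case using Nil by auto
    next
      case (Cons b v)
      let ?x = "if b then 2 else 1 :: nat"
      let ?C = "if b then Q else P"
      let ?c = "if b then a + 4 + code_length P else a + 3"
      have sti: "st i = s i" using Cons.prems by simp
      have x: "word_tape (st i) (g i) = ?x"
        using Cons.prems by (simp add: word_tape_def)
      have s1: "reaches M 1 (conf K (a + 2) st g) (conf K ?c st (g(i := g i + offset Stay)))"
        using M i x by (intro step_conf[where x = ?x]) (auto simp: eval_nat_numeral)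
      have g0: "g(i := g i + offset Stay) = g" by simp
      obtain g1 where
        s2: "reaches M (poly p N + poly q N) (conf K ?c st g)
          (conf K (?c + code_length ?C) (exec ?C st) g1)"
        and g1: "valid_heads ?A (exec ?C st) g1" "\<And>j. j \<in> ?A \<Longrightarrow> g1 j = g j"
        and len1: "\<And>j. length (exec ?C st j) \<le> length (st j) + (poly p N + poly q N)"
      proof (cases b)
        case True
        have "\<forall>j\<in>reads Q. length (st j) \<le> N" using N Cons.prems(2) by simp
        from simulated_withinD[OF q MQ Cons.prems(1) this]
        obtain g1 where *: "reaches M (poly q N) (conf K (a + 4 + code_length P) st g)
            (conf K (a + 4 + code_length P + code_length Q) (exec Q st) g1)"
          "valid_heads ?A (exec Q st) g1" "\<And>j. j \<in> ?A \<Longrightarrow> g1 j = g j"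
          "\<And>j. length (exec Q st j) \<le> length (st j) + poly q N"
          by metis
        show thesis
        proof (rule that)
          fix j show "length (exec ?C st j) \<le> length (st j) + (poly p N + poly q N)"
            using *(4)[of j] True by simp
          show "reaches M (poly p N + poly q N) (conf K ?c st g)
              (conf K (?c + code_length ?C) (exec ?C st) g1)"
            using reaches_mono[OF *(1), of "poly p N + poly q N"] True by simp
        qed (use * True in auto)
      next
        case False
        have "\<forall>j\<in>reads P. length (st j) \<le> N" using N Cons.prems(2) by simp
        from simulated_withinD[OF p MP Cons.prems(1) this]
        obtain g1 where *: "reaches M (poly p N) (conf K (a + 3) st g)
            (conf K (a + 3 + code_length P) (exec P st) g1)"
          "valid_heads ?A (exec P st) g1" "\<And>j. j \<in> ?A \<Longrightarrow> g1 j = g j"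
          "\<And>j. length (exec P st j) \<le> length (st j) + poly p N"
          by metis
        show thesis
        proof (rule that)
          fix j show "length (exec ?C st j) \<le> length (st j) + (poly p N + poly q N)"
            using *(4)[of j] False by simp
          show "reaches M (poly p N + poly q N) (conf K ?c st g)
              (conf K (?c + code_length ?C) (exec ?C st) g1)"
            using reaches_mono[OF *(1), of "poly p N + poly q N"] False by simp
        qed (use * False in auto)
      qed
      have s3: "reaches M 1 (conf K (?c + code_length ?C) (exec ?C st) g1)
          (conf K (a + 2) (exec ?C st) (g1(i := g1 i + offset MoveRight)))"
        using M i by (intro step_conf[where x = "word_tape (exec ?C st i) (g1 i)"])
          (auto simp: eval_nat_numeral add_ac)
      let ?g = "g1(i := g1 i + offset MoveRight)"
      have V: "valid_heads ?A (exec ?C st) ?g"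
        using g1 by (auto simp: valid_heads_def)
      have unch: "\<forall>j\<in>reads (Loop i P Q). exec ?C st j = s j"
      proof
        fix j assume j: "j \<in> reads (Loop i P Q)"
        then have "j \<notin> writes ?C" using disj by auto
        then show "exec ?C st j = s j" using Cons.prems(2) j exec_unchanged by metis
      qed
      have u: "s i = (u @ [b]) @ v" "?g i = int (length (u @ [b]))"
        using Cons.prems g1 by simp_all
      from Cons.IH[OF V unch u] obtain h' where
        s4: "reaches M (length v * ?B + 1) (conf K (a + 2) (exec ?C st) ?g)
            (conf K (a + code_length (Loop i P Q)) (fold ?body v (exec ?C st)) h')"
        and h': "valid_heads ?A (fold ?body v (exec ?C st)) h'" "h' i = int (length (s i))"
          "\<forall>j\<in>A. h' j = ?g j"
        and len: "\<And>j. length (fold ?body v (exec ?C st) j) \<le> length (exec ?C st j) + length v * ?B"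
        by blast
      have fold: "fold ?body (b # v) st = fold ?body v (exec ?C st)" by simp
      show ?case unfolding fold
      proof (intro conjI exI[of _ h'] allI)
        show "reaches M (length (b # v) * ?B + 1) (conf K (a + 2) st g)
           (conf K (a + code_length (Loop i P Q)) (fold ?body v (exec ?C st)) h')"
          using reaches_trans[OF reaches_trans[OF reaches_trans[OF s1[unfolded g0] s2] s3] s4]
          by (rule reaches_mono) simp
        show "\<forall>j\<in>A. h' j = g j" using h'(3) g1(2) i(2) by auto
        fix j
        show "length (fold ?body v (exec ?C st) j) \<le> length (st j) + length (b # v) * ?B"
          using len[of j] len1[of j] by simp
      qed (use h' in auto)
    qed
    have hi: "0 \<le> h i" "h i \<le> int (length (s i))"
      using h i by (auto simp: valid_heads_def)
    have t1: "reaches M 1 (conf K a s h) (conf K (a + 1) s (h(i := h i + offset MoveLeft)))"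
      using M i by (intro step_conf[where x = "word_tape (s i) (h i)"]) auto
    have t2: "reaches M (nat (h i) + 1) (conf K (a + 1) s (h(i := h i + offset MoveLeft)))
        (conf K (a + 2) s (h(i := 0)))"
      using reaches_rewind[OF M i(1), of "nat (h i)" s h] hi by simp
    have V: "valid_heads ?A s (h(i := 0))"
      using h by (auto simp: valid_heads_def)
    from iter[OF V, of "[]" "s i"] i(2) obtain h' where
      t3: "reaches M (length (s i) * ?B + 1) (conf K (a + 2) s (h(i := 0)))
            (conf K (a + code_length (Loop i P Q)) (exec (Loop i P Q) s) h')"
      and h': "valid_heads ?A (exec (Loop i P Q) s) h'" "h' i = int (length (s i))"
        "\<forall>j\<in>A. h' j = h j"
      and len: "\<And>j. length (exec (Loop i P Q) s j) \<le> length (s j) + length (s i) * ?B"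
      by auto
    have Ni: "length (s i) \<le> N" using N by simp
    then have bound: "length (s i) * ?B \<le> N * ?B" by (rule mult_le_mono1)
    show "\<exists>h'. reaches M (poly r N) (conf K a s h)
              (conf K (a + code_length (Loop i P Q)) (exec (Loop i P Q) s) h') \<and>
             valid_heads A (exec (Loop i P Q) s) h' \<and> (\<forall>j\<in>A. h' j = h j) \<and>
          (\<forall>j. length (exec (Loop i P Q) s j) \<le> length (s j) + poly r N)"
    proof (intro conjI exI[of _ h'] allI)
      have "1 + (nat (h i) + 1) + (length (s i) * ?B + 1) \<le> poly r N"
        using bound hi Ni unfolding r by linarith
      with reaches_trans[OF reaches_trans[OF t1 t2] t3]
      show "reaches M (poly r N) (conf K a s h)
              (conf K (a + code_length (Loop i P Q)) (exec (Loop i P Q) s) h')"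
        by (rule reaches_mono)
      \<comment> \<open>Scanning ends with head \<open>i\<close> right behind its unchanged word,
        the position that \<open>valid_heads A\<close> accepts now that \<open>i\<close> is no
        longer exempt.\<close>
      have "exec (Loop i P Q) s i = s i"
        using disj fold_exec_unchanged[of i P Q] by simp
      then show "valid_heads A (exec (Loop i P Q) s) h'"
        using h'(1,2) unfolding valid_heads_def by (metis insertE of_nat_0_le_iff order_refl)
      fix j
      show "length (exec (Loop i P Q) s j) \<le> length (s j) + poly r N"
        using len[of j] bound unfolding r by linarith
    qed (use h' in auto)
  qed
  then show ?case ..
qed

text \<open>The address behind the code is the accepting state, so a program halts by running off
  its end.\<close>

definition machine :: "nat \<Rightarrow> prog \<Rightarrow> tm" where
  "machine K P = \<lparr>num_tapes = K, num_symbols = 3, num_states = code_length P + 2, start = 0,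
     accept = code_length P, reject = code_length P + 1, delta = \<lambda>q. code P 0 ! q\<rparr>"

lemma is_tm_machine:
  assumes "wf_prog K {} P" "0 < K"
  shows "is_tm (machine K P)"
proof -
  have "case delta (machine K P) q ss of (q', acts) \<Rightarrow>
      q' < num_states (machine K P) \<and> length acts = num_tapes (machine K P) \<and>
      fst ` set acts \<subseteq> {..<num_symbols (machine K P)}"
    if "q < num_states (machine K P)" "\<not> halting (machine K P) q"
      "length ss = num_tapes (machine K P)" "set ss \<subseteq> {..<num_symbols (machine K P)}" for q ss
  proof -
    have "q < code_length P" using that by (auto simp: machine_def halting_def)
    then have "instr_ok K (code_length P) (code P 0 ! q)"
      by (intro instr_ok_code[OF assms(1), of 0]) auto
    then have "fst (delta (machine K P) q ss) \<le> code_length P \<and>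
        length (snd (delta (machine K P) q ss)) = K \<and>
        fst ` set (snd (delta (machine K P) q ss)) \<subseteq> {..<3}"
      using that unfolding instr_ok_def by (simp add: machine_def)
    then show ?thesis
      by (cases "delta (machine K P) q ss") (auto simp: machine_def)
  qed
  then show ?thesis using assms by (auto simp: is_tm_def machine_def)
qed

lemma code_at_nth:
  "(\<forall>n<length fs. \<not> halting M (a + n) \<and> delta M (a + n) = fs ! n) \<Longrightarrow> code_at M a fs"
proof (induction fs arbitrary: a)
  case (Cons f fs)
  have "\<forall>n<length fs. \<not> halting M (Suc a + n) \<and> delta M (Suc a + n) = fs ! n"
    using Cons.prems by (auto dest: spec[of _ "Suc _"])
  from Cons.IH[OF this] Cons.prems show ?case by (auto dest: spec[of _ 0])
qed simp

lemma code_at_machine: "code_at (machine K P) 0 (code P 0)"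
  by (intro code_at_nth) (auto simp: machine_def halting_def)

lemma polytime_computable_prog:
  assumes P: "wf_prog (Suc K) {} P"
    and f: "\<And>w. exec P ((\<lambda>_. [])(0 := w)) K = f w"
  shows "polytime_computable f"
proof -
  let ?M = "machine (Suc K) P"
  obtain q where q: "simulated_within (Suc K) {} P q"
    using exec_simulated[OF P] by blast
  have "computes_in_time ?M f (poly q)"
    unfolding computes_in_time_def
  proof
    fix w
    let ?s = "(\<lambda>_. [])(0 := w) :: store"
    have init: "initial ?M w = conf (Suc K) 0 ?s (\<lambda>_. 0)"
      by (auto simp: initial_def conf_def machine_def word_tape_Nil nth_Cons
          simp del: upt_Suc split: nat.split intro!: nth_equalityI)
    obtain h' where "reaches ?M (poly q (length w)) (conf (Suc K) 0 ?s (\<lambda>_. 0))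
        (conf (Suc K) (code_length P) (exec P ?s) h')"
    proof -
      have "valid_heads {} ?s (\<lambda>_. 0)" "\<forall>j\<in>reads P. length (?s j) \<le> length w"
        by (auto simp: valid_heads_def)
      from simulated_withinD[OF q code_at_machine[of "Suc K"] this] show thesis
        by (metis that add_0)
    qed
    then obtain t where "t \<le> poly q (length w)"
      "run ?M w t = conf (Suc K) (code_length P) (exec P ?s) h'"
      unfolding reaches_def run_def init by blast
    then show "\<exists>t\<le>poly q (length w). halting ?M (fst (run ?M w t)) \<and>
        fst (last (snd (run ?M w t))) = word_tape (f w)"
      using f[of w] by (intro exI[of _ t]) (auto simp: conf_def halting_def machine_def)
  qed
  then show ?thesis
    using is_tm_machine[OF P] unfolding polytime_computable_def by blast
qed


section \<open>Programs that write fixed words, repetitions and homomorphic images\<close>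

primrec puts :: "nat \<Rightarrow> bool list \<Rightarrow> prog" where
  "puts j [] = Skip"
| "puts j (b # u) = Seq (Put j b) (puts j u)"

lemma exec_puts [simp]: "exec (puts j u) s = s(j := s j @ u)"
  by (induction u arbitrary: s) auto

lemma wf_prog_puts [simp]: "0 < j \<Longrightarrow> j < K \<Longrightarrow> j \<notin> A \<Longrightarrow> wf_prog K A (puts j u)"
  by (induction u) auto

lemma reads_puts [simp]: "reads (puts j u) = {}"
  by (induction u) auto

lemma writes_puts: "writes (puts j u) \<subseteq> {j}"
  by (induction u) auto

lemma writes_puts_disjoint [simp]: "i \<noteq> j \<Longrightarrow> i \<notin> writes (puts j u)"
  using writes_puts by blast

definition for_each :: "nat \<Rightarrow> nat \<Rightarrow> (bool \<Rightarrow> bool list) \<Rightarrow> prog" where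
  "for_each i j g = Loop i (puts j (g False)) (puts j (g True))"

lemma exec_for_each:
  "exec (for_each i j g) s = s(j := s j @ concat (map g (s i)))"
proof -
  have "fold (\<lambda>b. if b then exec (puts j (g True)) else exec (puts j (g False))) v t
      = t(j := t j @ concat (map g v))" for v t
    by (induction v arbitrary: t) auto
  then show ?thesis by (simp add: for_each_def)
qed

lemma wf_prog_for_each [simp]:
  "0 < j \<Longrightarrow> j < K \<Longrightarrow> i < K \<Longrightarrow> i \<noteq> j \<Longrightarrow> i \<notin> A \<Longrightarrow> j \<notin> A \<Longrightarrow> wf_prog K A (for_each i j g)"
  by (simp add: for_each_def)

lemma reads_for_each [simp]: "reads (for_each i j g) = {i}"
  by (simp add: for_each_def)

lemma writes_for_each: "writes (for_each i j g) \<subseteq> {j}"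
  using writes_puts by (auto simp: for_each_def)

primrec unary :: "nat list \<Rightarrow> nat \<Rightarrow> prog" where
  "unary [] j = Skip"
| "unary (c # cs) j =
    (let P = for_each 0 j (\<lambda>_. [True])
     in Seq (unary cs (Suc j)) (Seq (Loop (Suc j) P P) (puts j (replicate c True))))"

lemma writes_unary: "writes (unary cs j) \<subseteq> {j..<j + length cs}"
proof (induction cs arbitrary: j)
  case (Cons c cs)
  show ?case
    using Cons[of "Suc j"] writes_for_each[of 0 j] writes_puts[of j]
    by (fastforce simp: Let_def)
qed simp

lemma wf_prog_unary:
  "0 < j \<Longrightarrow> j + length cs < K \<Longrightarrow> wf_prog K {} (unary cs j)"
proof (induction cs arbitrary: j)
  case (Cons c cs)
  then show ?case
    using writes_for_each[of 0 j "\<lambda>_. [True]"] by (auto simp: Let_def)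
qed simp

text \<open>Horner's rule in unary, with one tape per coefficient.\<close>

lemma exec_unary:
  "0 < j \<Longrightarrow> (\<And>i. j \<le> i \<Longrightarrow> s i = []) \<Longrightarrow>
    exec (unary cs j) s j = replicate (poly (Poly cs) (length (s 0))) True"
proof (induction cs arbitrary: j)
  case (Cons c cs)
  let ?P = "for_each 0 j (\<lambda>_. [True])"
  have loop: "fold (\<lambda>b. if b then exec ?P else exec ?P) v t
      = t(j := t j @ replicate (length v * length (t 0)) True)" if "0 < j" for v t
    using that by (induction v arbitrary: t)
      (auto simp: exec_for_each map_replicate_const replicate_add[symmetric] fun_eq_iff)
  let ?t = "exec (unary cs (Suc j)) s"
  have "j \<notin> writes (unary cs (Suc j))" "0 \<notin> writes (unary cs (Suc j))"
    using writes_unary[of cs "Suc j"] by (auto simp: subset_iff)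
  then have t: "?t j = []" "?t 0 = s 0"
    using Cons.prems by (auto simp: exec_unchanged)
  have "?t (Suc j) = replicate (poly (Poly cs) (length (s 0))) True"
    using Cons by simp
  then have "exec (Loop (Suc j) ?P ?P) ?t j
      = replicate (poly (Poly cs) (length (s 0)) * length (s 0)) True"
    using t loop[OF Cons.prems(1), of "?t (Suc j)" ?t] by (simp only: exec.simps fun_upd_same) simp
  moreover have "exec (unary (c # cs) j) s j = exec (Loop (Suc j) ?P ?P) ?t j @ replicate c True"
    by (simp add: Let_def del: exec.simps(4))
  ultimately show ?case
    by (simp add: replicate_add[symmetric] ac_simps)
qed simp

text \<open>The three kinds correspond to what a part of an instance depends on: the machine only,
  the exponent of the counter unit, or the input word.\<close>

datatype piece = Fixed "bool list" | Repeat "bool list" | Subst "bool \<Rightarrow> bool list"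

primrec piece_word :: "nat \<Rightarrow> bool list \<Rightarrow> piece \<Rightarrow> bool list" where
  "piece_word m w (Fixed u) = u"
| "piece_word m w (Repeat u) = concat (replicate m u)"
| "piece_word m w (Subst g) = concat (map g w)"

primrec emit_piece :: "nat \<Rightarrow> piece \<Rightarrow> prog" where
  "emit_piece j (Fixed u) = puts j u"
| "emit_piece j (Repeat u) = for_each 1 j (\<lambda>_. u)"
| "emit_piece j (Subst g) = for_each 0 j g"

lemma polytime_computable_pieces:
  fixes p :: "nat poly"
  shows "polytime_computable (\<lambda>w. concat (map (piece_word (poly p (length w)) w) ps))"
proof -
  \<comment> \<open>The Horner values occupy the tapes from 1 on, with the value of \<open>p\<close>
    on tape 1; the tape before \<open>K\<close> stays empty as the value of the empty polynomial,
    and \<open>K\<close> takes the output.\<close>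
  define K where "K = length (coeffs p) + 2"
  define E where "E = foldr (\<lambda>x P. Seq (emit_piece K x) P) ps Skip"
  have emit: "exec (emit_piece K x) s = s(K := s K @ piece_word m w x)"
    if "s 0 = w" "s 1 = replicate m True" for x s m w
    using that by (cases x) (auto simp: exec_for_each map_replicate_const)
  have E: "exec (foldr (\<lambda>x P. Seq (emit_piece K x) P) ps Skip) s
      = s(K := s K @ concat (map (piece_word m w) ps))"
    if "s 0 = w" "s 1 = replicate m True" for ps s m w
    using that
  proof (induction ps arbitrary: s)
    case (Cons x ps)
    have "K \<noteq> 0" "K \<noteq> 1" by (simp_all add: K_def)
    then have "exec (foldr (\<lambda>x P. Seq (emit_piece K x) P) ps Skip) (s(K := s K @ piece_word m w x))
      = (s(K := s K @ piece_word m w x))(K := (s(K := s K @ piece_word m w x)) K @ concat (map (piece_word m w) ps))"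
      using Cons.prems by (intro Cons.IH) auto
    then show ?case using emit[OF Cons.prems] by simp
  qed simp
  have "wf_prog (Suc K) {} (emit_piece K x)" for x
    by (cases x) (auto simp: K_def)
  then have "wf_prog (Suc K) {} E"
    unfolding E_def by (induction ps) auto
  then have wf: "wf_prog (Suc K) {} (Seq (unary (coeffs p) 1) E)"
    by (simp add: wf_prog_unary K_def)
  show ?thesis
  proof (rule polytime_computable_prog[OF wf])
    fix w
    let ?s = "(\<lambda>_. [])(0 := w) :: store"
    let ?t = "exec (unary (coeffs p) 1) ?s"
    have "0 \<notin> writes (unary (coeffs p) 1)" "K \<notin> writes (unary (coeffs p) 1)"
      using writes_unary[of "coeffs p" 1] by (auto simp: K_def subset_iff)
    then have "?t 0 = w" "?t K = []"
      by (auto simp: exec_unchanged K_def)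
    moreover have "?t 1 = replicate (poly p (length w)) True"
      by (subst exec_unary) auto
    ultimately show "exec (Seq (unary (coeffs p) 1) E) ?s K
        = concat (map (piece_word (poly p (length w)) w) ps)"
      using E[of ?t w "poly p (length w)" ps] by (simp add: E_def)
  qed
qed

section \<open>Semantic rules for concepts\<close>

text \<open>Disjunction is written \<open>Neg (Nor Cs)\<close>. Over a finite list it is a maximum
  that is attained, so value 1 singles out a disjunct of value 1.\<close>

primrec Nor :: "concept list \<Rightarrow> concept" where
  "Nor [] = Const 1"
| "Nor (C # Cs) = And (Neg C) (Nor Cs)"

definition Forall :: "nat \<Rightarrow> concept \<Rightarrow> concept" where
  "Forall R C = Neg (Exists R (Neg C))"

lemma wf_concept_Nor [simp]: "wf_concept (Nor Cs) \<longleftrightarrow> (\<forall>C\<in>set Cs. wf_concept C)"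
  by (induction Cs) auto

lemma wf_concept_Forall [simp]: "wf_concept (Forall R C) \<longleftrightarrow> wf_concept C"
  by (simp add: Forall_def)

lemma eval_range:
  assumes I: "is_interp I"
  shows "wf_concept C \<Longrightarrow> x \<in> indiv I \<Longrightarrow> 0 \<le> eval I C x \<and> eval I C x \<le> 1"
proof (induction C arbitrary: x)
  case (Atom p)
  then show ?case using I by (auto simp: is_interp_def)
next
  case (Exists R C)
  have role: "0 \<le> role_int I R x y" if "y \<in> indiv I" for y
    using I Exists.prems that by (auto simp: is_interp_def)
  have "eval I (Exists R C) x \<le> 1"
    using Exists by (auto intro!: cSUP_least min.coboundedI2)
  \<comment> \<open>Any individual bounds the supremum from below; \<open>x\<close> is at
    hand.\<close>
  moreover have "0 \<le> min (role_int I R x x) (eval I C x)"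
    using Exists role by auto
  then have "0 \<le> eval I (Exists R C) x"
    using cSUP_upper2[OF Exists_bdd_above[OF I] , of x "indiv I" x 0 R C] Exists.prems by auto
  ultimately show ?case by blast
next
  case (Minus C c)
  have "0 \<le> real_of_rat c" using Minus.prems by simp
  with Minus.IH[of x] Minus.prems show ?case
    by (auto simp del: zero_le_of_rat_iff)
next
  case (And C D)
  with And.IH[of x] show ?case by (auto intro: min.coboundedI1)
qed auto

lemma eval_Nor_eq_0_iff:
  assumes I: "is_interp I" and x: "x \<in> indiv I" and "\<forall>C\<in>set Cs. wf_concept C"
  shows "eval I (Nor Cs) x = 0 \<longleftrightarrow> (\<exists>C\<in>set Cs. eval I C x = 1)"
  using assms(3)
proof (induction Cs)
  case (Cons C Cs)
  have "0 \<le> 1 - eval I C x" "0 \<le> eval I (Nor Cs) x"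
    using eval_range[OF I _ x, of C] eval_range[OF I _ x, of "Nor Cs"] Cons.prems by auto
  then have "eval I (Nor (C # Cs)) x = 0 \<longleftrightarrow> eval I C x = 1 \<or> eval I (Nor Cs) x = 0"
    by (simp add: min_def) linarith
  with Cons show ?case by simp
qed simp

lemma eval_Nor_eq_1_iff:
  assumes I: "is_interp I" and x: "x \<in> indiv I" and "\<forall>C\<in>set Cs. wf_concept C"
  shows "eval I (Nor Cs) x = 1 \<longleftrightarrow> (\<forall>C\<in>set Cs. eval I C x = 0)"
  using assms(3)
proof (induction Cs)
  case (Cons C Cs)
  have "1 - eval I C x \<le> 1" "eval I (Nor Cs) x \<le> 1"
    using eval_range[OF I _ x, of C] eval_range[OF I _ x, of "Nor Cs"] Cons.prems by auto
  then have "eval I (Nor (C # Cs)) x = 1 \<longleftrightarrow> eval I C x = 0 \<and> eval I (Nor Cs) x = 1"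
    by (simp add: min_def) linarith
  with Cons show ?case by simp
qed simp

lemma eval_Exists_ge:
  assumes "is_interp I" "x \<in> indiv I" "y \<in> indiv I"
  shows "min (role_int I R x y) (eval I C y) \<le> eval I (Exists R C) x"
  using cSUP_upper[OF assms(3) Exists_bdd_above[OF assms(1,2) order_refl]] by simp

text \<open>The supremum need not be attained, so only thresholds below 1 can be reached; 3/4 is the
  upper end of the counter range.\<close>

lemma eval_Exists_eq_1D:
  assumes "is_interp I" "x \<in> indiv I" "eval I (Exists R C) x = 1"
  obtains y where "y \<in> indiv I" "role_int I R x y > 3/4" "eval I C y > 3/4"
proof -
  have "3/4 < (SUP y\<in>indiv I. min (role_int I R x y) (eval I C y))"
    using assms(3) by simp
  moreover have "indiv I \<noteq> {}" using assms(2) by blast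
  ultimately obtain y where "y \<in> indiv I" "3/4 < min (role_int I R x y) (eval I C y)"
    using less_cSUP_iff[OF _ Exists_bdd_above[OF assms(1,2) order_refl]] by meson
  then show thesis using that by simp
qed

text \<open>If a supremum is 0, no minimum below it is positive; hence, unlike an existential, a
  universal restriction of value 1 passes its full value to every successor of positive
  weight.\<close>

lemma eval_Forall_eq_1D:
  assumes "is_interp I" "x \<in> indiv I" "eval I (Forall R C) x = 1" "wf_concept C"
    and "y \<in> indiv I" "role_int I R x y > 0"
  shows "eval I C y = 1"
proof -
  have "min (role_int I R x y) (1 - eval I C y) \<le> 0"
    using eval_Exists_ge[OF assms(1,2,5), of R "Neg C"] assms(3) by (simp add: Forall_def)
  then show ?thesis
    using assms(6) eval_range[OF assms(1,4,5)] by (simp add: min_le_iff_disj)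
qed

text \<open>
  Values in the interval from 1/4 to 3/4 are passed on unchanged along role edges of weight
  above 3/4, which is all that a concept \<open>Exists R C\<close> of value 1 provides.
\<close>

definition link :: "nat \<Rightarrow> concept \<Rightarrow> concept \<Rightarrow> gci list" where
  "link R C D = [(C, Forall R D), (Exists R D, C)]"

text \<open>A weight above 3/4 exceeds both \<open>eval I C x\<close> and its complement, so in both
  minima the bound has to come from the value at \<open>y\<close>. The two GCIs thus give the two
  inequalities.\<close>

lemma link_eval:
  assumes "is_interp I" "x \<in> indiv I" "y \<in> indiv I" "role_int I R x y > 3/4"
    and "\<forall>(C, D) \<in> set (link R C D). eval I C x \<le> eval I D x"
    and "1/4 \<le> eval I C x" "eval I C x \<le> 3/4"
  shows "eval I D y = eval I C x"
proof -
  have "min (role_int I R x y) (eval I D y) \<le> eval I C x"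
    using eval_Exists_ge[OF assms(1-3), of R D] assms(5) by (auto simp: link_def)
  moreover have "min (role_int I R x y) (1 - eval I D y) \<le> 1 - eval I C x"
    using eval_Exists_ge[OF assms(1-3), of R "Neg D"] assms(5) by (auto simp: link_def Forall_def)
  ultimately show ?thesis
    using assms(4,6,7) by (simp add: min_le_iff_disj)
qed

section \<open>Computations as systems of cells\<close>

datatype side = Lower | Center | Upper

instance side :: countable
  by countable_datatype

instance move :: countable
  by countable_datatype

definition side_of :: "int \<Rightarrow> side" where
  "side_of i = (if i < 0 then Lower else if i = 0 then Center else Upper)"

text \<open>
  The cell at distance \<open>i\<close> from the heads consists of the side on which it lies, of the state, and
  of the symbols that stand at distance \<open>i\<close> from the head, on all tapes. Such relative positions make
  the cell at the heads carry all symbols read, so that no head has to be located.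
\<close>

type_synonym cell = "side \<times> nat \<times> nat list"

definition cell_of :: "config \<Rightarrow> int \<Rightarrow> cell" where
  "cell_of c i = (side_of i, fst c, map (\<lambda>(t, h). t (h + i)) (snd c))"

text \<open>Letting halting states write back what they read and stay makes the cell rule valid
  after the run has ended, too.\<close>

definition action :: "tm \<Rightarrow> nat \<Rightarrow> nat list \<Rightarrow> nat \<times> (nat \<times> move) list" where
  "action M q ss = (if halting M q then (q, map (\<lambda>s. (s, Stay)) ss) else delta M q ss)"

text \<open>What is at distance \<open>i\<close> from a head after its move \<open>d\<close> was at
  distance \<open>i + offset d\<close> before, so each tape consults the neighbour in the direction
  of its own move. If that neighbour is the center, the symbol is the one just written. The side is
  left out, since it depends on the offset only and is enforced by \<open>side_gcis\<close>.\<close>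

definition next_cell :: "tm \<Rightarrow> (move \<Rightarrow> cell) \<Rightarrow> cell \<Rightarrow> nat \<times> nat list" where
  "next_cell M nb home = (case home of (_, q, ss) \<Rightarrow> case action M q ss of (q', acts) \<Rightarrow>
     (q', map (\<lambda>j. case nb (snd (acts ! j)) of (sd, _, cs) \<Rightarrow>
        if sd = Center then fst (acts ! j) else cs ! j) [0..<num_tapes M]))"

definition valid_config :: "tm \<Rightarrow> config \<Rightarrow> bool" where
  "valid_config M c \<longleftrightarrow> fst c < num_states M \<and> length (snd c) = num_tapes M \<and>
     (\<forall>(t, h) \<in> set (snd c). \<forall>i. t i < num_symbols M)"

lemma step_action:
  "step M (q, ts) = (case action M q (map (\<lambda>(t, h). t h) ts) of (q', acts) \<Rightarrow>
     (q', map2 (\<lambda>(t, h) (a, d). (t(h := a), h + offset d)) ts acts))"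
proof (cases "halting M q")
  case True
  have "map2 (\<lambda>(t, h) (a, d). (t(h := a), h + offset d)) ts (map (\<lambda>s. (s, Stay)) (map (\<lambda>(t, h). t h) ts)) = ts"
    by (rule nth_equalityI) (auto split: prod.splits)
  with True show ?thesis by (simp add: step_def action_def del: map_map)
qed (simp add: step_def action_def)

lemma is_tm_delta:
  assumes "is_tm M" "q < num_states M" "\<not> halting M q" "length ss = num_tapes M"
    "set ss \<subseteq> {..<num_symbols M}" "delta M q ss = (q', acts)"
  shows "q' < num_states M \<and> length acts = num_tapes M \<and> fst ` set acts \<subseteq> {..<num_symbols M}"
proof -
  have "\<forall>q<num_states M. \<forall>ss. \<not> halting M q \<and> length ss = num_tapes M \<and>
      set ss \<subseteq> {..<num_symbols M} \<longrightarrow> (case delta M q ss of (q', acts) \<Rightarrow>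
        q' < num_states M \<and> length acts = num_tapes M \<and> fst ` set acts \<subseteq> {..<num_symbols M})"
    using assms(1) unfolding is_tm_def by (elim conjE)
  from this[rule_format, OF assms(2), of ss] assms(3-) show ?thesis by simp
qed

lemma valid_action:
  assumes M: "is_tm M" and c: "valid_config M (q, ts)"
    and a: "action M q (map (\<lambda>(t, h). t h) ts) = (q', acts)"
  shows "q' < num_states M" "length acts = num_tapes M" "fst ` set acts \<subseteq> {..<num_symbols M}"
proof -
  define ss where "ss = map (\<lambda>(t, h). t h) ts"
  have ss: "length ss = num_tapes M" "set ss \<subseteq> {..<num_symbols M}" and q: "q < num_states M"
    using c by (auto simp: valid_config_def ss_def)
  have a: "action M q ss = (q', acts)" using a by (simp add: ss_def)
  have "q' < num_states M \<and> length acts = num_tapes M \<and> fst ` set acts \<subseteq> {..<num_symbols M}"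
  proof (cases "halting M q")
    case True
    then have "q' = q" "acts = map (\<lambda>s. (s, Stay)) ss"
      using a by (simp_all add: action_def)
    then show ?thesis using ss q by (simp add: image_image)
  next
    case False
    then show ?thesis
      using is_tm_delta[OF M q False ss] a by (simp add: action_def)
  qed
  then show "q' < num_states M" "length acts = num_tapes M" "fst ` set acts \<subseteq> {..<num_symbols M}"
    by blast+
qed

lemma valid_step:
  assumes M: "is_tm M" and c: "valid_config M c"
  shows "valid_config M (step M c)"
proof -
  obtain q ts where c': "c = (q, ts)" by fastforce
  obtain q' acts where a: "action M q (map (\<lambda>(t, h). t h) ts) = (q', acts)" by fastforce
  note acts = valid_action[OF M c[unfolded c'] a]
  have len: "length ts = num_tapes M" using c by (simp add: c' valid_config_def)
  have "t i < num_symbols M"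
    if "(t, h) \<in> set (map2 (\<lambda>(t, h) (a, d). (t(h := a), h + offset d)) ts acts)" for t h i
  proof -
    from that obtain t0 h0 x d where z: "((t0, h0), (x, d)) \<in> set (zip ts acts)" and t: "t = t0(h0 := x)"
      by auto
    note set_zip_leftD[OF z] set_zip_rightD[OF z] t
    then show ?thesis using c acts(3) by (force simp: c' valid_config_def)
  qed
  then have "\<forall>(t, h) \<in> set (map2 (\<lambda>(t, h) (a, d). (t(h := a), h + offset d)) ts acts).
      \<forall>i. t i < num_symbols M"
    by blast
  then show ?thesis
    using acts len unfolding valid_config_def c' step_action a by simp
qed

lemma valid_run: "is_tm M \<Longrightarrow> valid_config M (run M w t)"
proof (induction t)
  case 0
  then show ?case
    by (auto simp: run_def initial_def valid_config_def is_tm_def word_tape_def)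
next
  case (Suc t)
  then show ?case using valid_step by (simp add: run_def)
qed

lemma side_of_eq_Center [simp]: "side_of i = Center \<longleftrightarrow> i = 0"
  by (simp add: side_of_def)

lemma next_cell_correct:
  assumes M: "is_tm M" and c: "valid_config M c"
  shows "next_cell M (\<lambda>d. cell_of c (i + offset d)) (cell_of c 0) = snd (cell_of (step M c) i)"
proof -
  obtain q ts where c': "c = (q, ts)" by fastforce
  obtain q' acts where a: "action M q (map (\<lambda>(t, h). t h) ts) = (q', acts)" by fastforce
  note acts = valid_action[OF M c[unfolded c'] a]
  have len: "length ts = num_tapes M" using c by (simp add: c' valid_config_def)
  have "map (\<lambda>j. case cell_of c (i + offset (snd (acts ! j))) of (sd, _, cs) \<Rightarrow>
        if sd = Center then fst (acts ! j) else cs ! j) [0..<num_tapes M]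
      = map (\<lambda>(t, h). t (h + i)) (map2 (\<lambda>(t, h) (a, d). (t(h := a), h + offset d)) ts acts)"
    using len acts(2)
    by (intro nth_equalityI) (auto simp: c' cell_of_def ac_simps split: prod.splits)
  then show ?thesis
    using a by (simp add: next_cell_def cell_of_def c' step_action)
qed

definition cells :: "tm \<Rightarrow> cell list" where
  "cells M = [(sd, q, cs). sd \<leftarrow> [Lower, Center, Upper], q \<leftarrow> [0..<num_states M],
     cs \<leftarrow> List.n_lists (num_tapes M) [0..<num_symbols M]]"

lemma set_cells:
  "set (cells M) = {(sd, q, cs). q < num_states M \<and> length cs = num_tapes M \<and> set cs \<subseteq> {..<num_symbols M}}"
proof -
  have "{Lower, Center, Upper} = UNIV"
    by (auto intro: side.exhaust)
  moreover have "set [0..<n] = {..<n}" for n by auto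
  moreover have "set (cells M) = {Lower, Center, Upper} \<times> set [0..<num_states M] \<times>
      {cs. length cs = num_tapes M \<and> set cs \<subseteq> set [0..<num_symbols M]}"
    unfolding cells_def by (auto simp: set_n_lists)
  ultimately show ?thesis by auto
qed

lemma cell_of_in_cells: "valid_config M c \<Longrightarrow> cell_of c i \<in> set (cells M)"
  by (auto simp: set_cells cell_of_def valid_config_def)

section \<open>The TBox of a computation\<close>

text \<open>
  The number of remaining computation steps and the distance from the heads are the values of
  \<open>Time\<close> and \<open>Offset\<close>, counted from 1/4 and 1/2 in units of \<open>eps e\<close>; the names ending in \<open>Pred\<close>
  hold values that are smaller by one unit. \<open>Walk sd s\<close> marks the individuals that look up
  whether the input word has the symbol \<open>s\<close> at the current offset.
\<close>

datatype name = Time | TimePred | Offset | OffsetPred | HalfPred | Initial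
  | Cell cell | Walk side nat

instance name :: countable
  by countable_datatype

datatype role = Down move | Home | Scan

instance role :: countable
  by countable_datatype

abbreviation atom :: "name \<Rightarrow> concept" where
  "atom a \<equiv> Atom (to_nat a)"

abbreviation some :: "role \<Rightarrow> concept \<Rightarrow> concept" where
  "some r \<equiv> Exists (to_nat r)"

abbreviation every :: "role \<Rightarrow> concept \<Rightarrow> concept" where
  "every r \<equiv> Forall (to_nat r)"

text \<open>In the unit interval, the minimum of v and 1 - v vanishes only at 0 and 1.\<close>

definition crisp :: "concept \<Rightarrow> gci" where
  "crisp C = (And C (Neg C), Const 0)"

definition walks :: "(side \<times> nat) list" where
  "walks = [(sd, s). sd \<leftarrow> [Center, Upper], s \<leftarrow> [0, 1, 2]]"

text \<open>When \<open>C\<close> has value 1, it drops out of the minimum. The relevant offsets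
  differ from 1/2 by multiples of the unit, so a strict comparison with 1/2 becomes a weak one after
  a shift by one unit.\<close>

primrec side_gcis :: "concept \<Rightarrow> side \<Rightarrow> gci list" where
  "side_gcis C Lower = [(And C (atom Offset), atom HalfPred)]"
| "side_gcis C Center = [(And C (atom Offset), Const (1/2)), (And C (Const (1/2)), atom Offset)]"
| "side_gcis C Upper = [(And C (Const (1/2)), atom OffsetPred)]"

primrec triple :: "'a \<times> 'a \<times> 'a \<Rightarrow> move \<Rightarrow> 'a" where
  "triple w MoveLeft = fst w"
| "triple w Stay = fst (snd w)"
| "triple w MoveRight = snd (snd w)"

definition window :: "cell \<times> cell \<times> cell \<Rightarrow> cell \<Rightarrow> concept" where
  "window w c = And (some (Down MoveLeft) (atom (Cell (triple w MoveLeft))))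
     (And (some (Down Stay) (atom (Cell (triple w Stay))))
     (And (some (Down MoveRight) (atom (Cell (triple w MoveRight))))
       (some Home (atom (Cell c)))))"

text \<open>The condition \<open>fst c = Center\<close> fixes the offset of the \<open>Home\<close>
  successor through the side GCIs; this replaces an offset link, which could not reset a
  counter.\<close>

definition windows :: "tm \<Rightarrow> cell \<Rightarrow> concept list" where
  "windows M a = [window w c. w \<leftarrow> List.product (cells M) (List.product (cells M) (cells M)),
     c \<leftarrow> cells M, fst c = Center \<and> next_cell M (triple w) c = snd a]"

definition step_gci :: "tm \<Rightarrow> cell \<Rightarrow> gci" where
  "step_gci M a = (And (atom (Cell a)) (Neg (atom Initial)), Neg (Nor (windows M a)))"

text \<open>\<open>Const 0\<close> refutes claims that fit no initial configuration. Left of its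
  head the input tape is blank, so a symbol has to be looked up on the other two sides only.\<close>

definition initial_gci :: "tm \<Rightarrow> cell \<Rightarrow> gci" where
  "initial_gci M = (\<lambda>(sd, q, cs). (And (atom (Cell (sd, q, cs))) (atom Initial),
     if q = start M \<and> set (tl cs) \<subseteq> {0} \<and> hd cs \<le> 2 \<and> (sd = Lower \<longrightarrow> hd cs = 0)
     then (if sd = Lower then Const 1 else atom (Walk sd (hd cs))) else Const 0))"

definition walk_gci :: "nat \<Rightarrow> gci" where
  "walk_gci s = (atom (Walk Upper s),
     Neg (Nor [some Scan (atom (Walk Center s)), some Scan (atom (Walk Upper s))]))"

text \<open>A move to the right uses the decrement backwards: the offset of an individual is linked
  with the value of \<open>OffsetPred\<close> at its successor.\<close>

definition link_gcis :: "gci list" where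
  "link_gcis =
     concat (map (\<lambda>r. link (to_nat r) (atom TimePred) (atom Time))
       [Down MoveLeft, Down Stay, Down MoveRight, Home]) @
     link (to_nat (Down MoveLeft)) (atom OffsetPred) (atom Offset) @
     link (to_nat (Down Stay)) (atom Offset) (atom Offset) @
     link (to_nat (Down MoveRight)) (atom Offset) (atom OffsetPred) @
     link (to_nat Scan) (atom OffsetPred) (atom Offset)"

text \<open>The two GCIs on time tie \<open>Initial\<close> to time 0: value 1 forces
  \<open>Time\<close> down to 1/4, and value 0 forces it to at least one unit above 1/4.\<close>

definition machine_gcis :: "tm \<Rightarrow> gci list" where
  "machine_gcis M =
     map crisp (atom Initial # map (\<lambda>a. atom (Cell a)) (cells M) @ map (\<lambda>(sd, s). atom (Walk sd s)) walks) @
     link_gcis @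
     concat (map (\<lambda>a. side_gcis (atom (Cell a)) (fst a)) (cells M)) @
     concat (map (\<lambda>(sd, s). side_gcis (atom (Walk sd s)) sd) walks) @
     [(And (atom Initial) (atom Time), Const (1/4)),
      (And (Neg (atom Initial)) (Const (1/4)), atom TimePred)] @
     map (step_gci M) (cells M) @ map (initial_gci M) (cells M) @ map walk_gci [0, 1, 2]"

text \<open>\<open>2 ^ e\<close> units make 1/4. Time thus runs from 1/4 to 1/2 and the offset
  deviates from 1/2 by at most 1/4, within the range that links transmit.\<close>

definition eps :: "nat \<Rightarrow> rat" where
  "eps e = 1 / 2 ^ (e + 2)"

text \<open>Naming the predecessors confines the constant that depends on the input to these five
  GCIs, so the links are the same for all \<open>e\<close>. \<open>HalfPred\<close> serves as an
  upper bound, for which one inequality suffices.\<close>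

definition counter_gcis :: "nat \<Rightarrow> gci list" where
  "counter_gcis e =
     [(Minus (atom Time) (eps e), atom TimePred), (atom TimePred, Minus (atom Time) (eps e)),
      (Minus (atom Offset) (eps e), atom OffsetPred), (atom OffsetPred, Minus (atom Offset) (eps e)),
      (atom HalfPred, Minus (Const (1/2)) (eps e))]"

text \<open>
  An individual at offset \<open>i\<close> is required to satisfy the check for the input word. Along the role
  \<open>Scan\<close> the offset decreases, so the individual reached at offset 0 is checked against the \<open>i\<close>-th letter.
\<close>

primrec word_check :: "bool list \<Rightarrow> concept" where
  "word_check [] = Nor (map atom [Walk Center 1, Walk Center 2, Walk Upper 1, Walk Upper 2])"
| "word_check (b # v) =
     And (Nor (map atom [Walk Center 0, Walk Center (if b then 1 else 2)]))
       (every Scan (word_check v))"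

definition tbox_list :: "tm \<Rightarrow> nat \<Rightarrow> bool list \<Rightarrow> gci list" where
  "tbox_list M e w = counter_gcis e @ (atom Initial, word_check w) # machine_gcis M"

definition sequent_list :: "tm \<Rightarrow> assertion list" where
  "sequent_list M =
     [(atom Time, Ge, 1/2), (atom Time, Le, 1/2),
      (Neg (Nor [atom (Cell a). a \<leftarrow> cells M, fst a = Center \<and> fst (snd a) = accept M]), Ge, 1)]"

section \<open>Well-formedness of the constructed instance\<close>

definition wf_gci :: "gci \<Rightarrow> bool" where
  "wf_gci = (\<lambda>(C, D). wf_concept C \<and> wf_concept D)"

lemma wf_side_gcis: "wf_concept C \<Longrightarrow> \<forall>g\<in>set (side_gcis C sd). wf_gci g"
  by (cases sd) (auto simp: wf_gci_def)

lemma wf_link: "wf_concept C \<Longrightarrow> wf_concept D \<Longrightarrow> \<forall>g\<in>set (link R C D). wf_gci g"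
  by (auto simp: link_def wf_gci_def)

lemma wf_word_check [simp]: "wf_concept (word_check v)"
  by (induction v) auto

lemma wf_windows: "C \<in> set (windows M a) \<Longrightarrow> wf_concept C"
  by (auto simp: windows_def window_def)

lemma eps_range: "0 < eps e" "eps e \<le> 1/4"
proof -
  have "(4::rat) \<le> 2 ^ (e + 2)"
    using one_le_power[of "2::rat" e] by simp
  then show "0 < eps e" "eps e \<le> 1/4"
    by (simp_all add: eps_def field_simps)
qed

lemma of_rat_eps: "real_of_rat (eps e) = 1 / 2 ^ (e + 2)"
  by (simp add: eps_def of_rat_divide of_rat_power of_rat_mult)

lemma wf_machine_gcis: "\<forall>g\<in>set (machine_gcis M). wf_gci g"
proof -
  have "\<forall>g\<in>set (map crisp (atom Initial # map (\<lambda>a. atom (Cell a)) (cells M) @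
      map (\<lambda>(sd, s). atom (Walk sd s)) walks)). wf_gci g"
    by (auto simp: crisp_def wf_gci_def)
  moreover have "\<forall>g\<in>set link_gcis. wf_gci g"
    using wf_link[of "atom _" "atom _"] unfolding link_gcis_def by force
  moreover have "\<forall>g\<in>set (concat (map (\<lambda>a. side_gcis (atom (Cell a)) (fst a)) (cells M))). wf_gci g"
    using wf_side_gcis[of "atom _"] by auto
  moreover have "\<forall>g\<in>set (concat (map (\<lambda>(sd, s). side_gcis (atom (Walk sd s)) sd) walks)). wf_gci g"
    using wf_side_gcis[of "atom _"] by auto
  moreover have "\<forall>g\<in>set (map (step_gci M) (cells M)). wf_gci g"
    by (auto simp: wf_gci_def step_gci_def wf_windows)
  moreover have "\<forall>g\<in>set (map (initial_gci M) (cells M)). wf_gci g"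
    by (auto simp: wf_gci_def initial_gci_def)
  moreover have "\<forall>g\<in>set (map walk_gci [0, 1, 2]). wf_gci g"
    by (auto simp: wf_gci_def walk_gci_def)
  moreover have "wf_gci (And (atom Initial) (atom Time), Const (1/4))"
    "wf_gci (And (Neg (atom Initial)) (Const (1/4)), atom TimePred)"
    by (auto simp: wf_gci_def)
  ultimately show ?thesis
    unfolding machine_gcis_def set_append ball_Un by simp
qed

lemma wf_tbox_list: "wf_tbox (set (tbox_list M e w))"
proof -
  have "0 \<le> eps e" "eps e \<le> 1" using eps_range[of e] by auto
  then have "\<forall>g\<in>set (counter_gcis e). wf_gci g"
    by (simp add: counter_gcis_def wf_gci_def)
  moreover have "wf_gci (atom Initial, word_check w)"
    by (simp add: wf_gci_def)
  ultimately have "\<forall>g\<in>set (tbox_list M e w). wf_gci g"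
    using wf_machine_gcis by (simp add: tbox_list_def ball_Un)
  then show ?thesis unfolding wf_tbox_def wf_gci_def by simp
qed

lemma wf_sequent_list: "wf_sequent (set (sequent_list M))"
  by (auto simp: wf_sequent_def sequent_list_def)

section \<open>Soundness\<close>

definition unit :: "nat \<Rightarrow> real" where
  "unit e = 1 / 2 ^ (e + 2)"

lemma unit_pos: "0 < unit e"
  by (simp add: unit_def)

lemma unit_bound: "2 ^ e * unit e = 1/4"
  by (simp add: unit_def)

lemma unit_mult_le: "k \<le> 2 ^ e \<Longrightarrow> k * unit e \<le> 1/4"
  using mult_right_mono[of k "2 ^ e" "unit e"] unit_pos[of e] unit_bound[of e] by simp

lemma unit_mult_abs: "\<bar>i\<bar> \<le> 2 ^ e \<Longrightarrow> \<bar>of_int i * unit e\<bar> \<le> 1/4"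
  using unit_mult_le[of "of_int \<bar>i\<bar>" e] unit_pos[of e] of_int_le_iff[of "\<bar>i\<bar>" "2 ^ e", where ?'a = real]
  by (simp add: abs_mult)

locale tbox_model =
  fixes I :: "'d interp" and M :: tm and e :: nat and w :: "bool list"
  assumes I: "is_interp I" and T: "satisfies_tbox I (set (tbox_list M e w))" and M: "is_tm M"
begin

abbreviation val :: "name \<Rightarrow> 'd \<Rightarrow> real" where
  "val a \<equiv> eval I (atom a)"

lemma gci: "(C, D) \<in> set (tbox_list M e w) \<Longrightarrow> x \<in> indiv I \<Longrightarrow> eval I C x \<le> eval I D x"
  using T by (auto simp: satisfies_tbox_def)

lemma machine_gci: "(C, D) \<in> set (machine_gcis M) \<Longrightarrow> x \<in> indiv I \<Longrightarrow> eval I C x \<le> eval I D x"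
  by (rule gci) (simp_all add: tbox_list_def)

lemma val_range: "x \<in> indiv I \<Longrightarrow> 0 \<le> val a x \<and> val a x \<le> 1"
  using eval_range[OF I, of "atom a" x] by simp

lemma crisp_val:
  assumes "(And (atom a) (Neg (atom a)), Const 0) \<in> set (machine_gcis M)" "x \<in> indiv I"
  shows "val a x = 0 \<or> val a x = 1"
  using machine_gci[OF assms] val_range[OF assms(2), of a] by (auto simp: min_def split: if_splits)

lemma crisp_Initial: "x \<in> indiv I \<Longrightarrow> val Initial x = 0 \<or> val Initial x = 1"
  by (rule crisp_val) (auto simp: machine_gcis_def crisp_def)

lemma crisp_Cell: "a \<in> set (cells M) \<Longrightarrow> x \<in> indiv I \<Longrightarrow> val (Cell a) x = 0 \<or> val (Cell a) x = 1"
  by (rule crisp_val) (auto simp: machine_gcis_def crisp_def)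

lemma set_walks: "(sd, s) \<in> set walks \<longleftrightarrow> sd \<in> {Center, Upper} \<and> s \<in> {0, 1, 2}"
  by (auto simp: walks_def)

lemma crisp_Walk: "(sd, s) \<in> set walks \<Longrightarrow> x \<in> indiv I \<Longrightarrow> val (Walk sd s) x = 0 \<or> val (Walk sd s) x = 1"
proof (rule crisp_val)
  assume "(sd, s) \<in> set walks"
  from imageI[OF this, of "\<lambda>(sd, s). atom (Walk sd s)"]
  have "atom (Walk sd s) \<in> set (map (\<lambda>(sd, s). atom (Walk sd s)) walks)" by simp
  then have "crisp (atom (Walk sd s)) \<in> set (machine_gcis M)"
    unfolding machine_gcis_def set_append set_map list.set by blast
  then show "(And (atom (Walk sd s)) (Neg (atom (Walk sd s))), Const 0) \<in> set (machine_gcis M)"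
    by (simp add: crisp_def)
qed

lemma Walk_side_gcis:
  assumes "(sd, s) \<in> set walks"
  shows "set (side_gcis (atom (Walk sd s)) sd) \<subseteq> set (machine_gcis M)"
proof -
  from imageI[OF assms, of "\<lambda>(sd, s). side_gcis (atom (Walk sd s)) sd"]
  have "side_gcis (atom (Walk sd s)) sd \<in> set (map (\<lambda>(sd, s). side_gcis (atom (Walk sd s)) sd) walks)"
    by simp
  then show ?thesis
    unfolding machine_gcis_def set_append set_concat by blast
qed

lemma Cell_side_gcis:
  assumes "a \<in> set (cells M)"
  shows "set (side_gcis (atom (Cell a)) (fst a)) \<subseteq> set (machine_gcis M)"
proof -
  from imageI[OF assms, of "\<lambda>a. side_gcis (atom (Cell a)) (fst a)"]
  have "side_gcis (atom (Cell a)) (fst a) \<in> set (map (\<lambda>a. side_gcis (atom (Cell a)) (fst a)) (cells M))"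
    by simp
  then show ?thesis
    unfolding machine_gcis_def set_append set_concat by blast
qed

lemma counters:
  assumes "x \<in> indiv I"
  shows "val TimePred x = max (val Time x - unit e) 0" "val OffsetPred x = max (val Offset x - unit e) 0"
    "val HalfPred x \<le> max (1/2 - unit e) 0"
proof -
  have *: "eval I C x \<le> eval I D x" if "(C, D) \<in> set (counter_gcis e)" for C D
    by (rule gci) (use that assms in \<open>auto simp: tbox_list_def\<close>)
  show "val TimePred x = max (val Time x - unit e) 0"
    using *[of "Minus (atom Time) (eps e)" "atom TimePred"] *[of "atom TimePred" "Minus (atom Time) (eps e)"]
    by (intro antisym) (simp_all add: counter_gcis_def of_rat_eps unit_def)
  show "val OffsetPred x = max (val Offset x - unit e) 0"
    using *[of "Minus (atom Offset) (eps e)" "atom OffsetPred"] *[of "atom OffsetPred" "Minus (atom Offset) (eps e)"]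
    by (intro antisym) (simp_all add: counter_gcis_def of_rat_eps unit_def)
  show "val HalfPred x \<le> max (1/2 - unit e) 0"
    using *[of "atom HalfPred" "Minus (Const (1/2)) (eps e)"]
    by (simp add: counter_gcis_def of_rat_eps unit_def of_rat_divide)
qed

lemma side_gcis_sound:
  assumes x: "x \<in> indiv I" and a: "val a x = 1" and P: "val Offset x = 1/2 + of_int i * unit e"
    and sd: "set (side_gcis (atom a) sd) \<subseteq> set (machine_gcis M)"
  shows "sd = side_of i"
proof -
  have g: "eval I C x \<le> eval I D x" if "(C, D) \<in> set (side_gcis (atom a) sd)" for C D
    using machine_gci[OF subsetD[OF sd that] x] .
  have range: "0 \<le> val Offset x" "val Offset x \<le> 1" using val_range[OF x] by auto
  note u = unit_pos[of e]
  have u2: "unit e \<le> 1/4" using unit_mult_le[of 1 e] by simp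
  show ?thesis
  proof (cases sd)
    case Lower
    then have "min 1 (val Offset x) \<le> max (1/2 - unit e) 0"
      using g[of "And (atom a) (atom Offset)" "atom HalfPred"] a counters(3)[OF x] by simp
    then have "of_int i * unit e < 0" using range P u u2 by (simp add: min_def max_def split: if_splits)
    then have "i < 0" using u by (simp add: mult_less_0_iff)
    then show ?thesis using Lower by (simp add: side_of_def)
  next
    case Center
    then have "val Offset x = 1/2"
      using g[of "And (atom a) (atom Offset)" "Const (1/2)"] g[of "And (atom a) (Const (1/2))" "atom Offset"]
        a range by (simp add: of_rat_divide min_def split: if_splits)
    then have "of_int i * unit e = 0" using P by simp
    then show ?thesis using u Center by (simp add: side_of_def)
  next
    case Upper
    then have "1/2 \<le> val OffsetPred x"
      using g[of "And (atom a) (Const (1/2))" "atom OffsetPred"] a by (simp add: of_rat_divide)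
    then have "0 < of_int i * unit e" using counters(2)[OF x] P u by linarith
    then have "0 < i" using u by (simp add: zero_less_mult_iff)
    then show ?thesis using Upper by (simp add: side_of_def)
  qed
qed

lemma offset_Center:
  assumes "x \<in> indiv I" "a \<in> set (cells M)" "val (Cell a) x = 1" "fst a = Center"
  shows "val Offset x = 1/2"
  using machine_gci[of "And (atom (Cell a)) (atom Offset)" "Const (1/2)", OF _ assms(1)]
    machine_gci[of "And (atom (Cell a)) (Const (1/2))" "atom Offset", OF _ assms(1)]
    Cell_side_gcis[OF assms(2)] assms(3,4) val_range[OF assms(1), of Offset]
  by (simp add: of_rat_divide min_def split: if_splits)

lemma link_sound:
  assumes "set (link (to_nat r) C D) \<subseteq> set link_gcis" "x \<in> indiv I" "y \<in> indiv I"
    "role_int I (to_nat r) x y > 3/4" "1/4 \<le> eval I C x" "eval I C x \<le> 3/4"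
  shows "eval I D y = eval I C x"
proof (rule link_eval[OF I assms(2-4) _ assms(5,6)])
  have "set link_gcis \<subseteq> set (machine_gcis M)"
    by (auto simp: machine_gcis_def)
  then show "\<forall>(C, D) \<in> set (link (to_nat r) C D). eval I C x \<le> eval I D x"
    using assms(1,2) machine_gci by blast
qed

text \<open>Crispness closes the gap between 3/4 and 1 that an unattained supremum leaves
  open.\<close>

lemma Exists_atom_sound:
  assumes "x \<in> indiv I" "eval I (some r (atom a)) x = 1"
    and "\<And>y. y \<in> indiv I \<Longrightarrow> val a y = 0 \<or> val a y = 1"
  obtains y where "y \<in> indiv I" "role_int I (to_nat r) x y > 3/4" "val a y = 1"
proof -
  obtain y where y: "y \<in> indiv I" "role_int I (to_nat r) x y > 3/4" "val a y > 3/4"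
    using eval_Exists_eq_1D[OF I assms(1,2)] by metis
  have "val a y = 1" using assms(3)[OF y(1)] y(3) by linarith
  with y(1,2) show thesis by (rule that)
qed

lemma time_sound:
  assumes "r \<in> {Down MoveLeft, Down Stay, Down MoveRight, Home}"
    "x \<in> indiv I" "y \<in> indiv I" "role_int I (to_nat r) x y > 3/4"
    "val Time x = 1/4 + real (Suc t) * unit e" "Suc t \<le> 2 ^ e"
  shows "val Time y = 1/4 + real t * unit e"
proof -
  have "real t * unit e \<le> 1/4" using assms(6) by (intro unit_mult_le) (simp add: le_nat_iff flip: of_nat_le_iff)
  moreover have "0 \<le> real t * unit e" using unit_pos[of e] by simp
  moreover have "real (Suc t) * unit e = real t * unit e + unit e" by (simp add: algebra_simps)
  ultimately have P: "val TimePred x = 1/4 + real t * unit e" "1/4 \<le> val TimePred x" "val TimePred x \<le> 3/4"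
    using counters(1)[OF assms(2)] assms(5) by linarith+
  have "set (link (to_nat r) (atom TimePred) (atom Time)) \<subseteq> set link_gcis"
    using assms(1) unfolding link_gcis_def set_append by auto
  from link_sound[OF this assms(2-4) P(2,3)] P(1) show ?thesis by simp
qed

lemma offset_pred_sound:
  assumes "r \<in> {Down MoveLeft, Scan}"
    "x \<in> indiv I" "y \<in> indiv I" "role_int I (to_nat r) x y > 3/4"
    "val Offset x = 1/2 + of_int i * unit e" "\<bar>i - 1\<bar> \<le> 2 ^ e"
  shows "val Offset y = 1/2 + of_int (i - 1) * unit e"
proof -
  have "\<bar>of_int (i - 1) * unit e\<bar> \<le> 1/4" by (rule unit_mult_abs) fact
  moreover have "val Offset x - unit e = 1/2 + of_int (i - 1) * unit e"
    using assms(5) by (simp add: algebra_simps)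
  ultimately have P: "val OffsetPred x = 1/2 + of_int (i - 1) * unit e"
    "1/4 \<le> val OffsetPred x" "val OffsetPred x \<le> 3/4"
    using counters(2)[OF assms(2)] by linarith+
  have "set (link (to_nat r) (atom OffsetPred) (atom Offset)) \<subseteq> set link_gcis"
    using assms(1) unfolding link_gcis_def set_append by blast
  from link_sound[OF this assms(2-4) P(2,3)] P(1) show ?thesis by simp
qed

lemma offset_succ_sound:
  assumes "x \<in> indiv I" "y \<in> indiv I" "role_int I (to_nat (Down MoveRight)) x y > 3/4"
    "val Offset x = 1/2 + of_int i * unit e" "\<bar>i\<bar> \<le> 2 ^ e"
  shows "val Offset y = 1/2 + of_int (i + 1) * unit e"
proof -
  have "\<bar>of_int i * unit e\<bar> \<le> 1/4" by (rule unit_mult_abs) fact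
  then have P: "1/4 \<le> val Offset x" "val Offset x \<le> 3/4"
    using assms(4) by linarith+
  have "set (link (to_nat (Down MoveRight)) (atom Offset) (atom OffsetPred)) \<subseteq> set link_gcis"
    unfolding link_gcis_def set_append by blast
  from link_sound[OF this assms(1-3) P] have "val OffsetPred y = val Offset x" .
  \<comment> \<open>The decrement at \<open>y\<close> can be inverted: its result is at least 1/4,
    so it was not truncated at 0.\<close>
  then have "val Offset y = val Offset x + unit e"
    using counters(2)[OF assms(2)] P(1) by (simp add: max_def split: if_splits)
  then show ?thesis
    using assms(4) by (simp add: algebra_simps)
qed

lemma offset_stay_sound:
  assumes "x \<in> indiv I" "y \<in> indiv I" "role_int I (to_nat (Down Stay)) x y > 3/4"
    "val Offset x = 1/2 + of_int i * unit e" "\<bar>i\<bar> \<le> 2 ^ e"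
  shows "val Offset y = 1/2 + of_int i * unit e"
proof -
  have "\<bar>of_int i * unit e\<bar> \<le> 1/4" by (rule unit_mult_abs) fact
  then have P: "1/4 \<le> val Offset x" "val Offset x \<le> 3/4"
    using assms(4) by linarith+
  have "set (link (to_nat (Down Stay)) (atom Offset) (atom Offset)) \<subseteq> set link_gcis"
    unfolding link_gcis_def set_append by blast
  from link_sound[OF this assms(1-3) P] assms(4) show ?thesis by simp
qed

text \<open>Each \<open>Scan\<close> edge lowers the offset and drops one letter of
  \<open>v\<close>, so the letter compared at offset 0 is the right one. If \<open>v\<close> runs
  out first, the position lies beyond the word; the check then excludes the nonblank symbols for
  both sides, and the walk need not be followed further.\<close>

lemma word_check_sound:
  "x \<in> indiv I \<Longrightarrow> eval I (word_check v) x = 1 \<Longrightarrow> (sd, s) \<in> set walks \<Longrightarrow> val (Walk sd s) x = 1 \<Longrightarrow>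
    val Offset x = 1/2 + of_int j * unit e \<Longrightarrow> 0 \<le> j \<Longrightarrow> j \<le> 2 ^ e \<Longrightarrow> s = word_tape v j"
proof (induction v arbitrary: x j sd)
  case Nil
  have "\<forall>C\<in>set (map atom [Walk Center 1, Walk Center 2, Walk Upper 1, Walk Upper 2]). eval I C x = 0"
    using Nil.prems(1,2) by (subst eval_Nor_eq_1_iff[OF I, symmetric]) auto
  then have "s = 0" using Nil.prems(3,4) by (auto simp: set_walks)
  then show ?case by (simp add: word_tape_def)
next
  case (Cons b v)
  let ?N = "Nor (map atom [Walk Center 0, Walk Center (if b then 1 else 2)])"
  have range: "eval I ?N x \<le> 1" "eval I (every Scan (word_check v)) x \<le> 1"
    using eval_range[OF I _ Cons.prems(1), of ?N] eval_range[OF I _ Cons.prems(1), of "every Scan (word_check v)"]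
    by auto
  then have N: "eval I ?N x = 1" and W: "eval I (every Scan (word_check v)) x = 1"
    using Cons.prems(2) unfolding word_check.simps eval.simps by (simp_all add: min_def split: if_splits)
  have "set (side_gcis (atom (Walk sd s)) sd) \<subseteq> set (machine_gcis M)"
    by (rule Walk_side_gcis) fact
  from side_gcis_sound[OF Cons.prems(1,4,5) this] have sd: "sd = side_of j" .
  show ?case
  proof (cases "j = 0")
    case True
    have "\<forall>C\<in>set (map atom [Walk Center 0, Walk Center (if b then 1 else 2)]). eval I C x = 0"
      using N Cons.prems(1) by (subst eval_Nor_eq_1_iff[OF I, symmetric]) auto
    then show ?thesis
      using True sd Cons.prems(3,4) by (auto simp: side_of_def set_walks word_tape_def split: if_splits)
  next
    case False
    then have sd: "sd = Upper" using sd Cons.prems(6) by (simp add: side_of_def)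
    let ?Cs = "[some Scan (atom (Walk Center s)), some Scan (atom (Walk Upper s))]"
    have "walk_gci s \<in> set (machine_gcis M)"
      using Cons.prems(3) by (auto simp: machine_gcis_def set_walks)
    then have "1 \<le> 1 - eval I (Nor ?Cs) x"
      using machine_gci[OF _ Cons.prems(1)] Cons.prems(4) sd unfolding walk_gci_def by fastforce
    moreover have "0 \<le> eval I (Nor ?Cs) x"
      using eval_range[OF I _ Cons.prems(1), of "Nor ?Cs"] by simp
    ultimately have "eval I (Nor ?Cs) x = 0" by linarith
    then have "\<exists>C\<in>set ?Cs. eval I C x = 1"
      by (subst eval_Nor_eq_0_iff[OF I Cons.prems(1), symmetric]) auto
    then obtain sd' where sd': "sd' \<in> {Center, Upper}" "eval I (some Scan (atom (Walk sd' s))) x = 1"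
      by auto
    then have w: "(sd', s) \<in> set walks" using Cons.prems(3) by (simp add: set_walks)
    from Exists_atom_sound[OF Cons.prems(1) sd'(2) crisp_Walk[OF w]] obtain y where
      y: "y \<in> indiv I" "role_int I (to_nat Scan) x y > 3/4" "val (Walk sd' s) y = 1" by blast
    have wy: "eval I (word_check v) y = 1"
      using eval_Forall_eq_1D[OF I Cons.prems(1) W _ y(1)] y(2) by simp
    have "val Offset y = 1/2 + of_int (j - 1) * unit e"
      using offset_pred_sound[of Scan x y j] Cons.prems y False by simp
    from Cons.IH[OF y(1) wy w y(3) this] have "s = word_tape v (j - 1)"
      using Cons.prems False by simp
    then show ?thesis using False Cons.prems(6)
      by (simp add: word_tape_def nth_Cons' nat_diff_distrib)
  qed
qed

lemma Nor_sound:
  assumes "x \<in> indiv I" "1 \<le> eval I (Neg (Nor Cs)) x" "\<forall>C\<in>set Cs. wf_concept C"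
  shows "\<exists>C\<in>set Cs. eval I C x = 1"
proof -
  have "eval I (Nor Cs) x = 0"
    using assms eval_range[OF I _ assms(1), of "Nor Cs"] by simp
  then show ?thesis using eval_Nor_eq_0_iff[OF I assms(1,3)] by simp
qed

text \<open>A claim with time left is justified by four claims with one step less, which are true by
  induction, and the machine is deterministic. The bound on \<open>i\<close> and \<open>t\<close>
  survives because a neighbour is at most one unit further away; it keeps all counters where links
  are exact.\<close>

lemma cell_sound:
  "x \<in> indiv I \<Longrightarrow> a \<in> set (cells M) \<Longrightarrow> val (Cell a) x = 1 \<Longrightarrow>
    val Time x = 1/4 + real t * unit e \<Longrightarrow> val Offset x = 1/2 + of_int i * unit e \<Longrightarrow>
    \<bar>i\<bar> + int t \<le> 2 ^ e \<Longrightarrow> a = cell_of (run M w t) i"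
proof (induction t arbitrary: x a i)
  case 0
  obtain sd q cs where a: "a = (sd, q, cs)" by (cases a)
  from side_gcis_sound[OF 0(1,3,5) Cell_side_gcis[OF 0(2)]] have sd: "sd = side_of i" by (simp add: a)
  have "val Initial x \<noteq> 0"
    using machine_gci[of "And (Neg (atom Initial)) (Const (1/4))" "atom TimePred", OF _ 0(1)]
      counters(1)[OF 0(1)] 0(4) unit_pos[of e] by (auto simp: machine_gcis_def of_rat_divide)
  then have Z: "val Initial x = 1" using crisp_Initial[OF 0(1)] by simp
  have "initial_gci M a \<in> set (machine_gcis M)"
    using 0(2) by (auto simp: machine_gcis_def)
  then have g: "1 \<le> eval I (snd (initial_gci M a)) x"
    using machine_gci[OF _ 0(1), of "fst (initial_gci M a)" "snd (initial_gci M a)"] 0(3) Z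
    by (simp add: initial_gci_def a)
  then have q: "q = start M" and tl: "set (tl cs) \<subseteq> {0}" and hd2: "hd cs \<le> 2"
    and low: "sd = Lower \<Longrightarrow> hd cs = 0"
    and walk: "sd \<noteq> Lower \<Longrightarrow> val (Walk sd (hd cs)) x = 1"
    using val_range[OF 0(1), of "Walk sd (hd cs)"] by (auto simp: initial_gci_def a split: if_splits)
  have hd: "hd cs = word_tape w i"
  proof (cases "sd = Lower")
    case True
    then show ?thesis using low sd by (simp add: side_of_def word_tape_def split: if_splits)
  next
    case False
    then have i: "0 \<le> i" using sd by (simp add: side_of_def split: if_splits)
    have "1 \<le> eval I (word_check w) x"
      using gci[of "atom Initial" "word_check w", OF _ 0(1)] Z by (simp add: tbox_list_def)
    then have "eval I (word_check w) x = 1"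
      using eval_range[OF I wf_word_check 0(1), of w] by linarith
    moreover have "hd cs = 0 \<or> hd cs = 1 \<or> hd cs = 2" using hd2 by linarith
    then have "(sd, hd cs) \<in> set walks" using False by (cases sd) (auto simp: set_walks)
    ultimately show ?thesis
      using word_check_sound[OF 0(1) _ _ walk[OF False] 0(5) i] 0(6) by simp
  qed
  have k: "length cs = num_tapes M" "1 \<le> num_tapes M"
    using 0(2) M by (auto simp: set_cells a is_tm_def)
  then have "cs = hd cs # tl cs" by (cases cs) auto
  moreover have "tl cs = replicate (num_tapes M - 1) 0"
    using tl k by (intro replicate_eqI) auto
  ultimately have "cs = word_tape w i # replicate (num_tapes M - 1) 0" using hd by simp
  then show ?case
    by (simp add: a sd q cell_of_def run_def initial_def)
next
  case (Suc t)
  from side_gcis_sound[OF Suc.prems(1,3,5) Cell_side_gcis[OF Suc.prems(2)]] have sd: "fst a = side_of i" .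
  have tN: "Suc t \<le> 2 ^ e"
    using Suc.prems(6) by (simp flip: of_nat_le_iff[where ?'a = int])
  have t0: "0 < real (Suc t) * unit e" using unit_pos[of e] by simp
  then have "1/4 < val Time x" using t0 Suc.prems(4) by linarith
  then have "val Initial x \<noteq> 1"
    using machine_gci[of "And (atom Initial) (atom Time)" "Const (1/4)", OF _ Suc.prems(1)]
    by (auto simp: machine_gcis_def of_rat_divide)
  then have Z: "val Initial x = 0" using crisp_Initial[OF Suc.prems(1)] by simp
  have "step_gci M a \<in> set (machine_gcis M)"
    using Suc.prems(2) by (auto simp: machine_gcis_def)
  then have "1 \<le> eval I (Neg (Nor (windows M a))) x"
    using machine_gci[OF _ Suc.prems(1), of "fst (step_gci M a)" "snd (step_gci M a)"] Suc.prems(3) Z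
    by (simp add: step_gci_def)
  from Nor_sound[OF Suc.prems(1) this] obtain l s r c where
    cells: "l \<in> set (cells M)" "s \<in> set (cells M)" "r \<in> set (cells M)" "c \<in> set (cells M)"
    and c: "fst c = Center" and nx: "next_cell M (triple (l, s, r)) c = snd a"
    and win: "eval I (window (l, s, r) c) x = 1"
    by (auto simp: windows_def wf_windows split: if_splits)
  have some: "\<exists>y\<in>indiv I. role_int I (to_nat \<rho>) x y > 3/4 \<and> val (Cell b) y = 1"
    if "eval I (some \<rho> (atom (Cell b))) x = 1" "b \<in> set (cells M)" for \<rho> b
    using Exists_atom_sound[OF Suc.prems(1) that(1) crisp_Cell[OF that(2)]] by blast
  have le1: "eval I (some \<rho> (atom (Cell b))) x \<le> 1" for \<rho> b
    using eval_range[OF I _ Suc.prems(1), of "some \<rho> (atom (Cell b))"] by simp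
  have "eval I (some (Down MoveLeft) (atom (Cell l))) x = 1" "eval I (some (Down Stay) (atom (Cell s))) x = 1"
    "eval I (some (Down MoveRight) (atom (Cell r))) x = 1" "eval I (some Home (atom (Cell c))) x = 1"
    using win le1[of "Down MoveLeft" l] le1[of "Down Stay" s] le1[of "Down MoveRight" r] le1[of Home c]
    unfolding window_def eval.simps(5) triple.simps fst_conv snd_conv by linarith+
  then obtain yl ys yr yc where
    yl: "yl \<in> indiv I" "role_int I (to_nat (Down MoveLeft)) x yl > 3/4" "val (Cell l) yl = 1" and
    ys: "ys \<in> indiv I" "role_int I (to_nat (Down Stay)) x ys > 3/4" "val (Cell s) ys = 1" and
    yr: "yr \<in> indiv I" "role_int I (to_nat (Down MoveRight)) x yr > 3/4" "val (Cell r) yr = 1" and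
    yc: "yc \<in> indiv I" "role_int I (to_nat Home) x yc > 3/4" "val (Cell c) yc = 1"
    using some cells by metis
  note time = time_sound[OF _ Suc.prems(1) _ _ Suc.prems(4) tN]
  have bound: "\<bar>i - 1\<bar> + int t \<le> 2 ^ e" "\<bar>i\<bar> + int t \<le> 2 ^ e" "\<bar>i + 1\<bar> + int t \<le> 2 ^ e"
    "\<bar>i - 1\<bar> \<le> 2 ^ e" "\<bar>i\<bar> \<le> 2 ^ e"
    using Suc.prems(6) by linarith+
  have l: "l = cell_of (run M w t) (i - 1)"
  proof (rule Suc.IH[OF yl(1) cells(1) yl(3)])
    show "val Time yl = 1/4 + real t * unit e" by (rule time[OF _ yl(1,2)]) simp
    show "val Offset yl = 1/2 + of_int (i - 1) * unit e"
      by (rule offset_pred_sound[OF _ Suc.prems(1) yl(1,2) Suc.prems(5) bound(4)]) (simp)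
  qed fact
  have s: "s = cell_of (run M w t) (i)"
  proof (rule Suc.IH[OF ys(1) cells(2) ys(3)])
    show "val Time ys = 1/4 + real t * unit e" by (rule time[OF _ ys(1,2)]) simp
    show "val Offset ys = 1/2 + of_int (i) * unit e"
      by (rule offset_stay_sound[OF Suc.prems(1) ys(1,2) Suc.prems(5) bound(5)])
  qed fact
  have r: "r = cell_of (run M w t) (i + 1)"
  proof (rule Suc.IH[OF yr(1) cells(3) yr(3)])
    show "val Time yr = 1/4 + real t * unit e" by (rule time[OF _ yr(1,2)]) simp
    show "val Offset yr = 1/2 + of_int (i + 1) * unit e"
      by (rule offset_succ_sound[OF Suc.prems(1) yr(1,2) Suc.prems(5) bound(5)])
  qed fact
  have "val Offset yc = 1/2"
    by (rule offset_Center) fact+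
  then have P: "val Offset yc = 1/2 + of_int 0 * unit e" by simp
  have c: "c = cell_of (run M w t) 0"
  proof (rule Suc.IH[OF yc(1) cells(4) yc(3) _ P])
    show "val Time yc = 1/4 + real t * unit e" by (rule time[OF _ yc(1,2)]) simp
    show "\<bar>0\<bar> + int t \<le> 2 ^ e" using bound(2) by linarith
  qed
  have "triple (l, s, r) = (\<lambda>d. cell_of (run M w t) (i + offset d))"
  proof
    fix d show "triple (l, s, r) d = cell_of (run M w t) (i + offset d)"
      using l s r by (cases d) auto
  qed
  then have "snd a = snd (cell_of (run M w (Suc t)) i)"
    using next_cell_correct[OF M valid_run[OF M], of w t i] nx c by (simp add: run_def)
  \<comment> \<open>State and symbols come from the window, the side from the offset.\<close>
  then show ?case using sd by (simp add: prod_eq_iff cell_of_def)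
qed

lemma accept_sound:
  assumes x: "x \<in> indiv I" and s: "satisfies_sequent I x (set (sequent_list M))"
  shows "fst (run M w (2 ^ e)) = accept M"
proof -
  let ?Cs = "[atom (Cell a). a \<leftarrow> cells M, fst a = Center \<and> fst (snd a) = accept M]"
  have "1 \<le> eval I (Neg (Nor ?Cs)) x" and T: "val Time x = 1/2"
    using s by (auto simp: satisfies_sequent_def sequent_list_def of_rat_divide)
  from Nor_sound[OF x this(1)] obtain a where
    a: "a \<in> set (cells M)" "fst a = Center" "fst (snd a) = accept M" "val (Cell a) x = 1"
    by (auto split: if_splits)
  have "val Offset x = 1/2"
    by (rule offset_Center) fact+
  \<comment> \<open>The time 1/2 that the sequent demands is 1/4 plus \<open>2 ^ e\<close>
    units.\<close>
  then have "a = cell_of (run M w (2 ^ e)) 0"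
    using T unit_bound[of e] by (intro cell_sound[OF x a(1,4)]) auto
  then show ?thesis using a(3) by (simp add: cell_of_def)
qed

end

section \<open>Completeness\<close>

text \<open>Grid nodes carry the true cells, tracks the lookups of a symbol. Tracks with a wrong
  symbol do no harm, since the word check reaches only those that start at initial grid
  nodes.\<close>

datatype node = Grid nat int | Track nat int

primrec distance :: "node \<Rightarrow> int" where
  "distance (Grid t i) = i"
| "distance (Track s i) = i"

lemma windowsI:
  assumes "l \<in> set (cells M)" "s \<in> set (cells M)" "r \<in> set (cells M)" "c \<in> set (cells M)"
    "fst c = Center" "next_cell M (triple (l, s, r)) c = snd a"
  shows "window (l, s, r) c \<in> set (windows M a)"
  using assms unfolding windows_def by simp blast

locale run_model =
  fixes M :: tm and e :: nat and w :: "bool list"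
  assumes M: "is_tm M"
begin

text \<open>Tracks are not initial, so their \<open>TimePred\<close> has to be at least 1/4; the
  value 1/2 achieves this even for the largest unit.\<close>

primrec time_value :: "node \<Rightarrow> real" where
  "time_value (Grid t i) = 1/4 + real t * unit e"
| "time_value (Track s i) = 1/2"

primrec symbol :: "node \<Rightarrow> nat option" where
  "symbol (Grid t i) = (if t = 0 \<and> 0 \<le> i then Some (word_tape w i) else None)"
| "symbol (Track s i) = Some s"

primrec node_cell :: "node \<Rightarrow> cell option" where
  "node_cell (Grid t i) = Some (cell_of (run M w t) i)"
| "node_cell (Track s i) = None"

primrec is_initial :: "node \<Rightarrow> bool" where
  "is_initial (Grid t i) = (t = 0)"
| "is_initial (Track s i) = False"

text \<open>Decrements need no maximum with 0: on \<open>nodes\<close>, time and offset are at least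
  1/4 and the unit is at most 1/4.\<close>

primrec name_value :: "name \<Rightarrow> node \<Rightarrow> real" where
  "name_value Time x = time_value x"
| "name_value TimePred x = time_value x - unit e"
| "name_value Offset x = 1/2 + of_int (distance x) * unit e"
| "name_value OffsetPred x = 1/2 + of_int (distance x - 1) * unit e"
| "name_value HalfPred x = 1/2 - unit e"
| "name_value Initial x = of_bool (is_initial x)"
| "name_value (Cell a) x = of_bool (node_cell x = Some a)"
| "name_value (Walk sd s) x = of_bool (symbol x = Some s \<and> side_of (distance x) = sd)"

primrec pred_node :: "(int \<Rightarrow> int) \<Rightarrow> node \<Rightarrow> node option" where
  "pred_node f (Grid t i) = (if t = 0 then None else Some (Grid (t - 1) (f i)))"
| "pred_node f (Track s i) = None"

text \<open>Roles are crisp partial functions, so an existential takes the value at the only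
  successor, or 0 if there is none.\<close>

primrec succ :: "role \<Rightarrow> node \<Rightarrow> node option" where
  "succ (Down d) x = pred_node (\<lambda>i. i + offset d) x"
| "succ Home x = pred_node (\<lambda>i. 0) x"
| "succ Scan x = (case symbol x of None \<Rightarrow> None
     | Some s \<Rightarrow> if 0 < distance x then Some (Track s (distance x - 1)) else None)"

text \<open>The bound on grid nodes is invariant under \<open>succ\<close>, since a step back in
  time widens the offset by at most one, and it keeps the counter values in the unit
  interval.\<close>

definition nodes :: "node set" where
  "nodes = {Grid t i | t i. \<bar>i\<bar> + int t \<le> 2 ^ e} \<union> {Track s i | s i. s \<le> 2 \<and> 0 \<le> i \<and> i \<le> 2 ^ e}"

definition model :: "node interp" where
  "model = \<lparr>indiv = nodes, atom_int = \<lambda>p. name_value (from_nat p),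
     role_int = \<lambda>R x y. of_bool (succ (from_nat R) x = Some y)\<rparr>"

lemma indiv_model [simp]: "indiv model = nodes"
  by (simp add: model_def)

lemma word_tape_le: "word_tape v i \<le> 2"
  by (simp add: word_tape_def)

lemma Grid_in_nodes: "Grid t i \<in> nodes \<longleftrightarrow> \<bar>i\<bar> + int t \<le> 2 ^ e"
  by (auto simp: nodes_def)

lemma Track_in_nodes: "Track s i \<in> nodes \<longleftrightarrow> s \<le> 2 \<and> 0 \<le> i \<and> i \<le> 2 ^ e"
  by (auto simp: nodes_def)

lemma pred_node_in_nodes:
  assumes "x \<in> nodes" "pred_node f x = Some y" "\<And>i. \<bar>f i\<bar> \<le> \<bar>i\<bar> + 1"
  shows "y \<in> nodes"
proof (cases x)
  case (Grid t i)
  then have y: "y = Grid (t - 1) (f i)" "0 < t" using assms(2) by (auto split: if_splits)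
  then have "int (t - 1) = int t - 1" by (simp add: of_nat_diff)
  then have "\<bar>f i\<bar> + int (t - 1) \<le> 2 ^ e"
    using assms(1)[unfolded Grid Grid_in_nodes] assms(3)[of i] by linarith
  then show ?thesis unfolding y Grid_in_nodes .
qed (use assms(2) in auto)

lemma succ_in_nodes:
  assumes "x \<in> nodes" "succ r x = Some y"
  shows "y \<in> nodes"
proof (cases r)
  case (Down d)
  have "\<bar>i + offset d\<bar> \<le> \<bar>i\<bar> + 1" for i by (cases d) auto
  then show ?thesis using assms pred_node_in_nodes[of x "\<lambda>i. i + offset d" y] by (simp add: Down)
next
  case Home
  show ?thesis using assms pred_node_in_nodes[of x "\<lambda>i. 0" y] by (simp add: Home)
next
  case Scan
  then obtain s where s: "symbol x = Some s" "0 < distance x" "y = Track s (distance x - 1)"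
    using assms(2) by (auto split: option.splits if_splits)
  then show ?thesis
    using assms(1) word_tape_le by (cases x) (auto simp: Grid_in_nodes Track_in_nodes split: if_splits)
qed

lemma unit_le: "unit e \<le> 1/4"
  using unit_mult_le[of 1 e] by simp

lemma distance_bound: "x \<in> nodes \<Longrightarrow> \<bar>of_int (distance x) * unit e\<bar> \<le> 1/4"
  by (rule unit_mult_abs) (auto simp: nodes_def)

lemma time_bound: "x \<in> nodes \<Longrightarrow> 1/4 \<le> time_value x \<and> time_value x \<le> 1/2"
proof (cases x)
  case (Grid t i)
  assume "x \<in> nodes"
  then have "\<bar>int t\<bar> \<le> 2 ^ e" unfolding Grid Grid_in_nodes by linarith
  from unit_mult_abs[OF this] have "real t * unit e \<le> 1/4" by simp
  moreover have "0 \<le> real t * unit e" using unit_pos[of e] by simp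
  ultimately show ?thesis using Grid by simp
qed simp

lemma name_value_range: "x \<in> nodes \<Longrightarrow> 0 \<le> name_value a x \<and> name_value a x \<le> 1"
  using distance_bound[of x] time_bound[of x] unit_le unit_pos[of e]
  by (cases a) (auto simp: algebra_simps)

lemma is_interp_model: "is_interp model"
proof -
  have "Grid 0 0 \<in> nodes" by (simp add: nodes_def)
  then have "nodes \<noteq> {}" by blast
  then show ?thesis
    using name_value_range by (auto simp: is_interp_def model_def)
qed

lemma eval_atom [simp]: "eval model (atom a) x = name_value a x"
  by (simp add: model_def)

lemma model_range: "wf_concept C \<Longrightarrow> x \<in> nodes \<Longrightarrow> 0 \<le> eval model C x \<and> eval model C x \<le> 1"
  using eval_range[OF is_interp_model] by simp

lemma role_model [simp]: "role_int model (to_nat r) x y = of_bool (succ r x = Some y)"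
  by (simp add: model_def)

lemma eval_some:
  assumes "x \<in> nodes" "wf_concept C"
  shows "eval model (some r C) x = (case succ r x of None \<Rightarrow> 0 | Some y \<Rightarrow> eval model C y)"
proof (cases "succ r x")
  case None
  have "(\<lambda>z. min (role_int model (to_nat r) x z) (eval model C z)) ` nodes = {0}"
    using None assms model_range[OF assms(2)] by (auto simp: image_iff min_def)
  then show ?thesis using None by simp
next
  case (Some y)
  have y: "y \<in> nodes" using succ_in_nodes[OF assms(1) Some] .
  have "(SUP z\<in>nodes. min (role_int model (to_nat r) x z) (eval model C z)) = eval model C y"
  proof (rule cSup_eq_maximum)
    show "eval model C y \<in> (\<lambda>z. min (role_int model (to_nat r) x z) (eval model C z)) ` nodes"
      using Some y model_range[OF assms(2) y] by (auto simp: image_iff min_def intro!: bexI[of _ y])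
    fix v assume "v \<in> (\<lambda>z. min (role_int model (to_nat r) x z) (eval model C z)) ` nodes"
    then obtain z where "v = min (of_bool (y = z)) (eval model C z)" using Some by auto
    then show "v \<le> eval model C y"
      using model_range[OF assms(2) y] by (cases "y = z") auto
  qed
  then show ?thesis using Some by simp
qed

lemma eval_every:
  assumes "x \<in> nodes" "wf_concept C"
  shows "eval model (every r C) x = (case succ r x of None \<Rightarrow> 1 | Some y \<Rightarrow> eval model C y)"
  using eval_some[of x "Neg C" r] assms by (simp add: Forall_def split: option.splits)

section \<open>Validity of the GCIs in the model of the run\<close>

definition holds :: "gci \<Rightarrow> bool" where
  "holds g \<longleftrightarrow> (\<forall>x\<in>nodes. eval model (fst g) x \<le> eval model (snd g) x)"

lemma holds_crisp:
  assumes "\<And>x. x \<in> nodes \<Longrightarrow> name_value a x \<in> {0, 1}"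
  shows "holds (crisp (atom a))"
  unfolding holds_def crisp_def
proof
  fix x assume "x \<in> nodes"
  from assms[OF this]
  show "eval model (fst (And (atom a) (Neg (atom a)), Const 0)) x
      \<le> eval model (snd (And (atom a) (Neg (atom a)), Const 0)) x"
    by (auto simp del: eval.simps(1))
qed

lemma holds_link:
  assumes "\<And>x y. x \<in> nodes \<Longrightarrow> succ r x = Some y \<Longrightarrow> name_value b y = name_value a x"
  shows "\<forall>g\<in>set (link (to_nat r) (atom a) (atom b)). holds g"
  using assms name_value_range
  by (auto simp: holds_def link_def eval_some eval_every simp del: eval.simps(1,6) split: option.split)

lemma holds_side_gcis:
  assumes Q: "\<And>x. x \<in> nodes \<Longrightarrow> name_value a x = of_bool (Q x)"
    and sd: "\<And>x. x \<in> nodes \<Longrightarrow> Q x \<Longrightarrow> side_of (distance x) = sd"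
  shows "\<forall>g\<in>set (side_gcis (atom a) sd). holds g"
proof -
  have *: "eval model C x \<le> eval model D x" if g: "(C, D) \<in> set (side_gcis (atom a) sd)" and x: "x \<in> nodes" for C D x
  proof (cases "Q x")
    case False
    have "eval model C x \<le> 0"
      using g Q[OF x] False by (cases sd) (auto simp: min_def simp del: eval.simps(1))
    moreover have "wf_gci (C, D)" using wf_side_gcis[of "atom a" sd] g by auto
    then have "0 \<le> eval model D x" using model_range[of D x] x by (simp add: wf_gci_def)
    ultimately show ?thesis by linarith
  next
    case True
    note s = sd[OF x True]
    show ?thesis
    proof (cases sd)
      case Lower
      then have "distance x \<le> -1" using s by (auto simp: side_of_def split: if_splits)
      then have "of_int (distance x) * unit e \<le> -1 * unit e"
        using unit_pos[of e] by (intro mult_right_mono) auto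
      then show ?thesis using g Lower Q[OF x] True by (auto simp del: eval.simps(1))
    next
      case Center
      then have "distance x = 0" using s by simp
      then show ?thesis using g Center Q[OF x] True by (auto simp: of_rat_divide simp del: eval.simps(1))
    next
      case Upper
      then have "1 \<le> distance x" using s by (auto simp: side_of_def split: if_splits)
      then have "0 \<le> of_int (distance x - 1) * unit e"
        using unit_pos[of e] by (intro mult_nonneg_nonneg) auto
      then show ?thesis using g Upper Q[OF x] True
        by (auto simp: of_rat_divide simp del: eval.simps(1) of_int_diff)
    qed
  qed
  then show ?thesis by (auto simp: holds_def)
qed

lemma holds_link_gcis: "\<forall>g\<in>set link_gcis. holds g"
proof -
  have pred: "\<exists>t i. x = Grid (Suc t) i \<and> y = Grid t (f i)" if "pred_node f x = Some y" for f x y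
  proof (cases x)
    case (Grid t i)
    then show ?thesis using that by (cases t) auto
  qed (use that in auto)
  have time: "\<forall>g\<in>set (link (to_nat r) (atom TimePred) (atom Time)). holds g"
    if r: "r \<in> {Down MoveLeft, Down Stay, Down MoveRight, Home}" for r
  proof (rule holds_link)
    fix x y assume "succ r x = Some y"
    then obtain f where "pred_node f x = Some y" using r by auto
    from pred[OF this] show "name_value Time y = name_value TimePred x"
      by (auto simp: algebra_simps)
  qed
  moreover have "\<forall>g\<in>set (link (to_nat (Down MoveLeft)) (atom OffsetPred) (atom Offset)). holds g"
    by (rule holds_link) (auto dest: pred)
  moreover have "\<forall>g\<in>set (link (to_nat (Down Stay)) (atom Offset) (atom Offset)). holds g"
    by (rule holds_link) (auto dest: pred)
  moreover have "\<forall>g\<in>set (link (to_nat (Down MoveRight)) (atom Offset) (atom OffsetPred)). holds g"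
    by (rule holds_link) (auto dest: pred)
  moreover have "\<forall>g\<in>set (link (to_nat Scan) (atom OffsetPred) (atom Offset)). holds g"
    by (rule holds_link) (auto split: option.splits if_splits)
  ultimately show ?thesis
    using time[of "Down MoveLeft"] time[of "Down Stay"] time[of "Down MoveRight"] time[of Home]
    unfolding link_gcis_def by (simp add: ball_Un)
qed

lemma holds_crisp_below:
  assumes "\<And>x. x \<in> nodes \<Longrightarrow> Q x \<Longrightarrow> eval model D x = 1" "wf_concept D"
    "\<And>x. x \<in> nodes \<Longrightarrow> eval model C x = of_bool (Q x)"
  shows "holds (C, D)"
  using assms model_range[OF assms(2)] by (auto simp: holds_def)

lemma holds_step_gci:
  assumes "a \<in> set (cells M)"
  shows "holds (step_gci M a)"
  unfolding step_gci_def
proof (rule holds_crisp_below[where Q = "\<lambda>x. node_cell x = Some a \<and> \<not> is_initial x"])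
  fix x assume x: "x \<in> nodes" and Q: "node_cell x = Some a \<and> \<not> is_initial x"
  \<comment> \<open>A node with a cell that is not initial is a grid node at positive time; the
    inner case split is on that time.\<close>
  then obtain t i where xt: "x = Grid (Suc t) i"
    by (cases x; cases "case x of Grid t i \<Rightarrow> t | _ \<Rightarrow> 0") auto
  define c where "c = run M w t"
  have c: "valid_config M c" by (simp add: c_def valid_run[OF M])
  have a: "a = cell_of (step M c) i" using Q by (simp add: xt c_def run_def)
  let ?W = "(cell_of c (i - 1), cell_of c i, cell_of c (i + 1))"
  have "triple ?W = (\<lambda>d. cell_of c (i + offset d))"
  proof
    fix d show "triple ?W d = cell_of c (i + offset d)" by (cases d) auto
  qed
  then have "next_cell M (triple ?W) (cell_of c 0) = snd a"
    using next_cell_correct[OF M c, of i] a by simp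
  then have "window ?W (cell_of c 0) \<in> set (windows M a)"
    by (intro windowsI cell_of_in_cells[OF c]) (simp add: cell_of_def)
  moreover have "eval model (window ?W (cell_of c 0)) x = 1"
    using x by (simp add: window_def eval_some xt c_def del: eval.simps(1,6))
  ultimately have "\<exists>C\<in>set (windows M a). eval model C x = 1" by blast
  then have "eval model (Nor (windows M a)) x = 0"
    using eval_Nor_eq_0_iff[OF is_interp_model] x wf_windows by simp
  then show "eval model (Neg (Nor (windows M a))) x = 1" by simp
qed (use wf_windows in \<open>auto simp del: eval.simps(1)\<close>)

lemma run_0: "run M w 0 = (start M, (word_tape w, 0) # replicate (num_tapes M - 1) (\<lambda>_. 0, 0))"
  by (simp add: run_def initial_def)

lemma holds_initial_gci: "holds (initial_gci M a)"
proof -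
  obtain sd q cs where a: "a = (sd, q, cs)" by (cases a)
  show ?thesis
    unfolding a initial_gci_def prod.case
  proof (rule holds_crisp_below[where Q = "\<lambda>x. node_cell x = Some (sd, q, cs) \<and> is_initial x"])
    fix x assume x: "x \<in> nodes" and Q: "node_cell x = Some (sd, q, cs) \<and> is_initial x"
    then obtain i where xi: "x = Grid 0 i" by (cases x) auto
    have a: "sd = side_of i" "q = start M" "cs = word_tape w i # replicate (num_tapes M - 1) 0"
      using Q by (auto simp: xi cell_of_def run_0)
    show "eval model (if q = start M \<and> set (tl cs) \<subseteq> {0} \<and> hd cs \<le> 2 \<and> (sd = Lower \<longrightarrow> hd cs = 0)
        then if sd = Lower then Const 1 else atom (Walk sd (hd cs)) else Const 0) x = 1"
      using word_tape_le[of w i]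
      by (auto simp: a xi side_of_def word_tape_def simp del: eval.simps(1) split: if_splits)
  qed (auto simp del: eval.simps(1))
qed

lemma holds_walk_gci: "holds (walk_gci s)"
  unfolding walk_gci_def
proof (rule holds_crisp_below[where Q = "\<lambda>x. symbol x = Some s \<and> side_of (distance x) = Upper"])
  let ?Cs = "[some Scan (atom (Walk Center s)), some Scan (atom (Walk Upper s))]"
  fix x assume x: "x \<in> nodes" and Q: "symbol x = Some s \<and> side_of (distance x) = Upper"
  then have d: "0 < distance x" by (auto simp: side_of_def split: if_splits)
  have "\<exists>C\<in>set ?Cs. eval model C x = 1"
    using x Q d by (auto simp: eval_some side_of_def simp del: eval.simps(1,6))
  then have "eval model (Nor ?Cs) x = 0"
    using eval_Nor_eq_0_iff[OF is_interp_model, of x ?Cs] x by simp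
  then show "eval model (Neg (Nor ?Cs)) x = 1" by simp
qed (auto simp del: eval.simps(1))

lemma eval_Nor_atoms:
  assumes "x \<in> nodes" "\<And>a. a \<in> set as \<Longrightarrow> name_value a x = 0"
  shows "eval model (Nor (map atom as)) x = 1"
  using assms eval_Nor_eq_1_iff[OF is_interp_model, of x "map atom as"] by (simp del: eval.simps(1))

text \<open>The check is imposed on all initial nodes, also on those left of the head. These have no
  symbol, so their \<open>Walk\<close> names are 0, they have no \<open>Scan\<close> successor, and
  the check holds vacuously.\<close>

lemma eval_word_check:
  "x \<in> nodes \<Longrightarrow> (\<And>s. symbol x = Some s \<Longrightarrow> s = word_tape v (distance x)) \<Longrightarrow>
    eval model (word_check v) x = 1"
proof (induction v arbitrary: x)
  case Nil
  have "symbol x \<noteq> Some s" if "s \<noteq> 0" for s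
    using Nil.prems(2)[of s] that by (auto simp: word_tape_Nil)
  then show ?case
    using Nil.prems(1) unfolding word_check.simps by (intro eval_Nor_atoms) auto
next
  case (Cons b v)
  have N: "eval model (Nor (map atom [Walk Center 0, Walk Center (if b then 1 else 2)])) x = 1"
    using Cons.prems by (intro eval_Nor_atoms) (auto simp: word_tape_def split: if_splits)
  have "eval model (every Scan (word_check v)) x = 1"
  proof (cases "succ Scan x")
    case None
    then show ?thesis using Cons.prems(1) by (simp add: eval_every del: succ.simps)
  next
    case (Some y)
    then obtain s where s: "symbol x = Some s" "0 < distance x" "y = Track s (distance x - 1)"
      by (auto split: option.splits if_splits)
    have "s = word_tape v (distance y)"
      using Cons.prems(2)[OF s(1)] s(2,3) by (auto simp: word_tape_def nth_Cons' nat_diff_distrib)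
    then have "eval model (word_check v) y = 1"
      using Cons.IH[of y] succ_in_nodes[OF Cons.prems(1) Some] s(3) by simp
    then show ?thesis using Some Cons.prems(1) by (simp add: eval_every del: succ.simps)
  qed
  then show ?case using N unfolding word_check.simps eval.simps(5) by simp
qed

lemma holds_counter_gcis: "\<forall>g\<in>set (counter_gcis e). holds g"
proof -
  have "real_of_rat (eps e) = unit e" by (simp add: of_rat_eps unit_def)
  then show ?thesis
    using time_bound distance_bound unit_le
    by (force simp: counter_gcis_def holds_def of_rat_divide algebra_simps simp del: eval.simps(1))
qed

lemma holds_machine_gcis: "\<forall>g\<in>set (machine_gcis M). holds g"
proof -
  have "\<forall>g\<in>set (map crisp (atom Initial # map (\<lambda>a. atom (Cell a)) (cells M) @
      map (\<lambda>(sd, s). atom (Walk sd s)) walks)). holds g"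
    by (auto intro!: holds_crisp)
  moreover have "\<forall>g\<in>set (concat (map (\<lambda>a. side_gcis (atom (Cell a)) (fst a)) (cells M))). holds g"
  proof -
    have "\<forall>g\<in>set (side_gcis (atom (Cell a)) (fst a)). holds g" for a
    proof (rule holds_side_gcis)
      fix x assume "x \<in> nodes" "node_cell x = Some a"
      then show "side_of (distance x) = fst a" by (cases x) (auto simp: cell_of_def)
    qed simp
    then show ?thesis by auto
  qed
  moreover have "\<forall>g\<in>set (concat (map (\<lambda>(sd, s). side_gcis (atom (Walk sd s)) sd) walks)). holds g"
  proof -
    have "\<forall>g\<in>set (side_gcis (atom (Walk sd s)) sd). holds g" for sd s
      by (rule holds_side_gcis[where Q = "\<lambda>x. symbol x = Some s \<and> side_of (distance x) = sd"]) auto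
    then show ?thesis by auto
  qed
  moreover have "holds (And (atom Initial) (atom Time), Const (1/4))"
  proof -
    have "eval model (And (atom Initial) (atom Time)) x \<le> 1/4" if "x \<in> nodes" for x
      by (cases x) (auto simp: min_def simp del: eval.simps(1))
    then show ?thesis by (simp add: holds_def of_rat_divide del: eval.simps(1,5))
  qed
  moreover have "holds (And (Neg (atom Initial)) (Const (1/4)), atom TimePred)"
  proof -
    have "eval model (And (Neg (atom Initial)) (Const (1/4))) x \<le> eval model (atom TimePred) x"
      if "x \<in> nodes" for x
    proof (cases x)
      case (Grid t i)
      show ?thesis
      proof (cases t)
        case (Suc t')
        have "0 \<le> real t' * unit e" using unit_pos[of e] by simp
        then show ?thesis
          using Grid Suc by (simp add: of_rat_divide algebra_simps del: eval.simps(1))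
      qed (use Grid unit_le in \<open>simp del: eval.simps(1)\<close>)
    qed (use unit_le in \<open>simp add: of_rat_divide del: eval.simps(1)\<close>)
    then show ?thesis by (simp add: holds_def del: eval.simps)
  qed
  ultimately show ?thesis
    using holds_link_gcis holds_step_gci holds_initial_gci holds_walk_gci
    unfolding machine_gcis_def set_append ball_Un by simp
qed

lemma satisfies_tbox_model: "satisfies_tbox model (set (tbox_list M e w))"
proof -
  have "holds (atom Initial, word_check w)"
  proof (rule holds_crisp_below[where Q = is_initial])
    fix x assume "x \<in> nodes" "is_initial x"
    then show "eval model (word_check w) x = 1"
      by (intro eval_word_check) (cases x; auto split: if_splits)+
  qed (auto simp del: eval.simps(1))
  then have "\<forall>g\<in>set (tbox_list M e w). holds g"
    using holds_counter_gcis holds_machine_gcis by (simp add: tbox_list_def ball_Un)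
  then show ?thesis by (auto simp: satisfies_tbox_def holds_def)
qed

lemma accept_complete:
  assumes "fst (run M w (2 ^ e)) = accept M"
  shows "satisfiable (set (tbox_list M e w)) (set (sequent_list M))"
proof (rule satisfiableI[OF is_interp_model satisfies_tbox_model])
  let ?x = "Grid (2 ^ e) 0"
  let ?Cs = "[atom (Cell a). a \<leftarrow> cells M, fst a = Center \<and> fst (snd a) = accept M]"
  let ?a = "cell_of (run M w (2 ^ e)) 0"
  show x: "?x \<in> indiv model" by (simp add: Grid_in_nodes)
  have "atom (Cell ?a) \<in> set ?Cs"
    using cell_of_in_cells[OF valid_run[OF M], of w "2 ^ e" 0] assms by (auto simp: cell_of_def)
  moreover have "eval model (atom (Cell ?a)) ?x = 1" by (simp del: eval.simps(1))
  ultimately have "\<exists>C\<in>set ?Cs. eval model C ?x = 1" by blast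
  then have "eval model (Nor ?Cs) ?x = 0"
    using eval_Nor_eq_0_iff[OF is_interp_model x, of ?Cs] by auto
  moreover have "eval model (atom Time) ?x = 1/2"
    using unit_bound[of e] by (simp del: eval.simps(1))
  ultimately show "satisfies_sequent model ?x (set (sequent_list M))"
    by (simp add: satisfies_sequent_def sequent_list_def of_rat_divide del: eval.simps(1))
qed

end

section \<open>The reduction\<close>

text \<open>With the least significant digit first, every zero digit gives the same block. This is
  why the unit is a power of 1/2: its encoding is a repetition with a fixed end.\<close>

lemma enc_nat_power_2: "enc_nat (2 ^ m) = concat (replicate m [True, False]) @ [True, True, False]"
  by (induction m) (simp_all add: enc_nat_pos enc_nat_0)

text \<open>The front is the sign and the numerator 1. The exponent \<open>e + 2\<close> leaves two
  zero digits, which join the leading digit in the fixed tail.\<close>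

lemma enc_rat_eps:
  "enc_rat (eps e) = (False # enc_nat 1) @ concat (replicate e [True, False])
     @ [True, False, True, False, True, True, False]"
proof -
  have "eps e = Fract 1 (2 ^ (e + 2))"
    by (simp add: eps_def Fract_of_int_quotient)
  then have "quotient_of (eps e) = (1, 2 ^ (e + 2))"
    by (simp add: quotient_of_Fract normalize_stable)
  moreover have "nat (2 ^ (e + 2)) = 2 ^ (e + 2)"
    by (simp add: nat_power_eq nat_mult_distrib)
  moreover have "concat (replicate (e + 2) [True, False])
      = concat (replicate e [True, False]) @ [True, False, True, False]"
    unfolding replicate_add concat_append by (simp add: numeral_2_eq_2)
  ultimately show ?thesis
    using enc_nat_power_2[of "e + 2"] by (simp add: enc_rat_def)
qed

text \<open>In the encodings of \<open>And\<close>, \<open>Neg\<close> and \<open>Exists\<close> the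
  last argument stands at the end, so a concept nested there is encoded by one open prefix per
  letter. This makes the word check a homomorphic image of the input.\<close>

definition check_letter :: "bool \<Rightarrow> bool list" where
  "check_letter b = [True, False, False]
     @ enc_concept (Nor (map atom [Walk Center 0, Walk Center (if b then 1 else 2)]))
     @ [False, True, False] @ [True, False, True] @ enc_nat (to_nat Scan) @ [False, True, False]"

lemma enc_word_check:
  "enc_concept (word_check v) = concat (map check_letter v) @ enc_concept (word_check [])"
  by (induction v) (simp_all add: check_letter_def Forall_def)

definition eps_pieces :: "piece list" where
  "eps_pieces = [Fixed (False # enc_nat 1), Repeat [True, False],
     Fixed [True, False, True, False, True, True, False]]"

lemma eps_pieces: "concat (map (piece_word e w) eps_pieces) = enc_rat (eps e)"
  by (simp add: eps_pieces_def enc_rat_eps)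

text \<open>The encoding is cut at the five occurrences of \<open>eps e\<close> and around the word
  check. A single \<open>True\<close> is the continuation mark of \<open>enc_list\<close>, and
  \<open>[False, True, True]\<close> is the tag of \<open>Minus\<close>.\<close>

definition instance_pieces :: "tm \<Rightarrow> piece list" where
  "instance_pieces M =
     Fixed (enc_list enc_assertion (sequent_list M) @
       [True, False, True, True] @ enc_concept (atom Time)) # eps_pieces @
     Fixed (enc_concept (atom TimePred) @
       [True] @ enc_concept (atom TimePred) @ [False, True, True] @ enc_concept (atom Time)) # eps_pieces @
     Fixed ([True, False, True, True] @ enc_concept (atom Offset)) # eps_pieces @
     Fixed (enc_concept (atom OffsetPred) @
       [True] @ enc_concept (atom OffsetPred) @ [False, True, True] @ enc_concept (atom Offset)) # eps_pieces @
     Fixed ([True] @ enc_concept (atom HalfPred) @ [False, True, True] @ enc_concept (Const (1/2))) # eps_pieces @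
     [Fixed ([True] @ enc_concept (atom Initial)), Subst check_letter,
      Fixed (enc_concept (word_check []) @ enc_list enc_gci (machine_gcis M))]"

lemma instance_pieces:
  "concat (map (piece_word e w) (instance_pieces M)) = enc_instance (sequent_list M) (tbox_list M e w)"
  using enc_word_check[of w]
  by (simp add: instance_pieces_def eps_pieces enc_instance_def tbox_list_def counter_gcis_def enc_gci_def
      del: word_check.simps enc_concept.simps(1,2))

text \<open>Lets acceptance be read off at time \<open>2 ^ e\<close> exactly, the one time of which
  the sequent speaks.\<close>

lemma run_halting: "halting M (fst (run M w t)) \<Longrightarrow> run M w (t + k) = run M w t"
  by (induction k) (auto simp: run_def step_def split: prod.splits)

lemma satisfiable_iff:
  assumes M: "is_tm M"
    and run: "\<exists>t\<le>2 ^ e. fst (run M w t) = (if w \<in> L then accept M else reject M)"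
  shows "satisfiable (set (tbox_list M e w)) (set (sequent_list M)) \<longleftrightarrow> w \<in> L"
proof -
  obtain t where t: "t \<le> 2 ^ e" "fst (run M w t) = (if w \<in> L then accept M else reject M)"
    using run by blast
  have "run M w (t + (2 ^ e - t)) = run M w t"
    by (rule run_halting) (simp add: t halting_def)
  then have acc: "fst (run M w (2 ^ e)) = accept M \<longleftrightarrow> w \<in> L"
    using t M by (auto simp: is_tm_def)
  interpret run_model M e w
    using M by unfold_locales
  show ?thesis
  proof
    assume "satisfiable (set (tbox_list M e w)) (set (sequent_list M))"
    then obtain I :: "nat interp" and x where sat: "is_interp I" "satisfies_tbox I (set (tbox_list M e w))"
      "x \<in> indiv I" "satisfies_sequent I x (set (sequent_list M))"
      unfolding satisfiable_def by blast
    then interpret tbox_model I M e w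
      using M by unfold_locales
    show "w \<in> L" using accept_sound[OF sat(3,4)] acc by simp
  qed (use accept_complete acc in simp)
qed

theorem theorem4: "EXPTIME_hard fuzzy_ALC_sat"
  unfolding EXPTIME_hard_def
proof
  fix L assume "L \<in> EXPTIME"
  then obtain M and p :: "nat poly" where M: "is_tm M" and L: "decides_in_time M L (\<lambda>n. 2 ^ poly p n)"
    by (auto simp: EXPTIME_def)
  let ?f = "\<lambda>w. enc_instance (sequent_list M) (tbox_list M (poly p (length w)) w)"
  have "polytime_computable ?f"
    using polytime_computable_pieces[of p "instance_pieces M"] by (simp add: instance_pieces)
  moreover have "w \<in> L \<longleftrightarrow> ?f w \<in> fuzzy_ALC_sat" for w
    using satisfiable_iff[OF M, of "poly p (length w)" w L] L
    by (simp add: enc_instance_in_fuzzy_ALC_sat_iff wf_sequent_list wf_tbox_list decides_in_time_def)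
  ultimately show "polytime_reducible L fuzzy_ALC_sat"
    unfolding polytime_reducible_def by blast
qed

end
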